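(* Let $n\ge 2$, $\beta\ge 1$, let $\Omega\subset\mathbb{R}^n$ be a $\beta$-John domain, and let $s\in(0,1)$, $1<p\le q<\infty$, $a\ge 0$ and $b\in\mathbb{R}$ satisfy $$b<\frac{(n+a)p}{q\beta}+\frac{p-1}{\beta}+sp-p+1-n$$ and, additionally, $q\le\frac{np}{n-sp}$ when $p<\frac{n}{s}$. Then there exists a constant $C>0$, independent of $f$, such that for every $f\in C^\infty(\Omega)$ $$ \inf_{c\in\mathbb{R}}\|f-c\|_{L^q(\Omega,d^a)}\le C\left\{\int_\Omega\int_{|x-z|\le d(x)/2}\frac{|f(z)-f(x)|^p}{|z-x|^{n+sp}}\,\delta(x,z)^b\,dz\,dx\right\}^{1/p}. $$
   Context: $d(x)=\mathrm{dist}(x,\partial\Omega)$ for $x\in\Omega$; $\delta(x,z)=\min\{d(x),d(z)\}$; $\|g\|_{L^q(\Omega,d^a)}=\left(\int_\Omega |g(y)|^q d(y)^a\,dy\right)^{1/q}$. Both sides of the inequality are allowed to take the value $+\infty$. $\beta$-John domain ($\beta\ge 1$): it is assumed that $0\in\Omega$. A bounded domain $\Omega\subset\mathbb{R}^n$ is a $\beta$-John domain if there exist a family of rectifiable curves $\gamma(t,y)$, $0\le t\le 1$, $y\in\Omega$, and positive constants $\lambda,K,C_0$ such that: (1) $\gamma(0,y)=y$ and $\gamma(1,y)=0$; (2) $d(\gamma(t,y))\ge\lambda t^\beta$; (3) $|\dot\gamma(t,y)|\le K$, where the dot denotes the derivative in $t$; (4) for all $x,y\in\Omega$ and $r\le\frac12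 d(x)$, $\ell(\gamma(y)\cap B(x,r))\le C_0 r$, where $\gamma(y)$ denotes the curve $\gamma(\cdot,y)$ joining $y$ with $0$ and $\ell$ denotes length. *)

theory Defs
  imports "HOL-Analysis.Analysis"
begin

definition bdist :: "'a::euclidean_space set \<Rightarrow> 'a \<Rightarrow> real" where
  "bdist \<Omega> x = infdist x (frontier \<Omega>)"

(* Only meant for exponents r > 0. *)
definition ennreal_powr :: "ennreal \<Rightarrow> real \<Rightarrow> ennreal" where
  "ennreal_powr u r = (if u = \<infinity> then \<infinity> else ennreal (enn2real u powr r))"

primrec Ck_on :: "nat \<Rightarrow> ('a::euclidean_space \<Rightarrow> real) \<Rightarrow> 'a set \<Rightarrow> bool" where
  "Ck_on 0 f S \<longleftrightarrow> continuous_on S f"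
| "Ck_on (Suc k) f S \<longleftrightarrow>
     (\<forall>x\<in>S. f differentiable (at x)) \<and>
     (\<forall>v. Ck_on k (\<lambda>x. frechet_derivative f (at x) v) S)"

(* Meant for open S. *)
definition smooth_on :: "('a::euclidean_space \<Rightarrow> real) \<Rightarrow> 'a set \<Rightarrow> bool" where
  "smooth_on f S \<longleftrightarrow> (\<forall>k. Ck_on k f S)"

(* The length of the part of the curve g traced during the times in T: the supremum of the
   lengths of polygons inscribed over finitely many non-overlapping closed intervals in T.
   For T = {0..1} this is the usual length of g; for T relatively open in {0..1} it is the sum
   of the lengths of g over the connected components of T, counted with multiplicity. *)
definition curve_length :: "(real \<Rightarrow> 'a::euclidean_space) \<Rightarrow> real set \<Rightarrow> ennreal" where
  "curve_length g T =
     (SUP D \<in> {D. D division_of \<Union>D \<and> \<Union>D \<subseteq> T}. \<Sum>k\<in>D. ennreal (dist (g (Inf k)) (g (Sup k))))"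

definition rectifiable_curve :: "(real \<Rightarrow> 'a::euclidean_space) \<Rightarrow> bool" where
  "rectifiable_curve g \<longleftrightarrow> path g \<and> curve_length g {0..1} < \<infinity>"

(* g' exists almost everywhere and is bounded by K there. A bound on g' controls a rectifiable
   curve only if the parametrization is absolutely continuous (a Cantor-type parametrization has
   g' = 0 almost everywhere). In the presence of the bound, absolute continuity is the same as
   being Lipschitz with some constant. *)
definition speed_bounded :: "(real \<Rightarrow> 'a::euclidean_space) \<Rightarrow> real \<Rightarrow> bool" where
  "speed_bounded g K \<longleftrightarrow>
     (\<exists>L. L-lipschitz_on {0..1} g) \<and>
     (AE t in lborel. t \<in> {0..1} \<longrightarrow>
        (\<exists>v. (g has_vector_derivative v) (at t within {0..1}) \<and> norm v \<le> K))"

(* \<gamma> y is the curve joining y with 0, so \<gamma> y t is the point written \<gamma>(t,y) on paper. *)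
definition beta_John_domain :: "real \<Rightarrow> 'a::euclidean_space set \<Rightarrow> bool" where
  "beta_John_domain \<beta> \<Omega> \<longleftrightarrow>
     open \<Omega> \<and> connected \<Omega> \<and> bounded \<Omega> \<and> 0 \<in> \<Omega> \<and>
     (\<exists>(\<gamma> :: 'a \<Rightarrow> real \<Rightarrow> 'a) lam K C0. lam > 0 \<and> K > 0 \<and> C0 > 0 \<and>
        (\<forall>y\<in>\<Omega>. rectifiable_curve (\<gamma> y) \<and> \<gamma> y ` {0..1} \<subseteq> \<Omega> \<and>
           \<gamma> y 0 = y \<and> \<gamma> y 1 = 0 \<and>
           (\<forall>t\<in>{0..1}. bdist \<Omega> (\<gamma> y t) \<ge> lam * t powr \<beta>) \<and>
           speed_bounded (\<gamma> y) K \<and>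
           (\<forall>x\<in>\<Omega>. \<forall>r. 0 < r \<and> r \<le> bdist \<Omega> x / 2 \<longrightarrow>
              curve_length (\<gamma> y) {t \<in> {0..1}. \<gamma> y t \<in> ball x r} \<le> ennreal (C0 * r))))"

definition weighted_Lq_norm ::
  "'a::euclidean_space set \<Rightarrow> real \<Rightarrow> real \<Rightarrow> ('a \<Rightarrow> real) \<Rightarrow> ennreal" where
  "weighted_Lq_norm \<Omega> q a g =
     ennreal_powr (\<integral>\<^sup>+y\<in>\<Omega>. ennreal (\<bar>g y\<bar> powr q * bdist \<Omega> y powr a) \<partial>lborel) (1 / q)"

definition fractional_seminorm ::
  "'a::euclidean_space set \<Rightarrow> real \<Rightarrow> real \<Rightarrow> real \<Rightarrow> ('a \<Rightarrow> real) \<Rightarrow> ennreal" where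
  "fractional_seminorm \<Omega> s p b f =
     ennreal_powr
       (\<integral>\<^sup>+x\<in>\<Omega>.
          (\<integral>\<^sup>+z\<in>{z. norm (x - z) \<le> bdist \<Omega> x / 2}.
             ennreal (\<bar>f z - f x\<bar> powr p / norm (z - x) powr (real DIM('a) + s * p)
                        * min (bdist \<Omega> x) (bdist \<Omega> z) powr b) \<partial>lborel) \<partial>lborel)
       (1 / p)"

end

theory Submission
  imports Defs
begin

text \<open>Write \<open>d\<close> for the distance to the boundary, \<open>n\<close> for the dimension and \<open>G x\<close> for the inner integral of
\<open>|f z - f x|\<^sup>p / |z - x|\<^bsup>n + s p\<^esup>\<close> over \<open>|z - x| \<le> d x / 2\<close>. On that ball \<open>d z\<close> is comparable to \<open>d x\<close>, so
the right-hand side controls \<open>M = \<integral> G d\<^sup>b\<close>. The constant \<open>c\<close> is the mean of \<open>f\<close> over the ball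
\<open>B(0, d 0 / 20)\<close>, and \<open>f y - c\<close> is split at \<open>m y\<close>, the mean of \<open>f\<close> over \<open>B(y, d y / 20)\<close>. Everything
rests on two consequences of Jensen's inequality: \<open>f x\<close> differs from its mean over \<open>B(x, \<rho>)\<close> by at
most a constant times \<open>\<rho>\<^sup>s (G x)\<^bsup>1/p\<^esup>\<close> (\<open>pointwise_mean_oscillation\<close>), and the means over two
overlapping balls of radius about \<open>r\<close> differ by at most a constant times
\<open>(r\<^bsup>s p - n\<^esup> \<integral>\<^bsub>B(x,r)\<^esub> G)\<^bsup>1/p\<^esup>\<close> (\<open>adjacent_means_oscillation\<close>).

The local part \<open>|f y - m y|\<close> follows Hedberg's argument: for every radius \<open>\<rho> \<le> d y / 20\<close> it is at
most the oscillation at scale \<open>\<rho>\<close>, bounded by \<open>\<rho>\<^sup>s (G y)\<^bsup>1/p\<^esup>\<close>, plus a geometric sum over the scales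
above \<open>\<rho>\<close>, bounded by \<open>\<rho>\<^bsup>s - n/p\<^esup> (d y)\<^bsup>-b/p\<^esup> M\<^bsup>1/p\<^esup>\<close>. Here \<open>G\<close> itself stands where the classical
argument has a maximal function. Optimising \<open>\<rho>\<close> gives the pointwise bound
\<open>|f - m|\<^sup>q d\<^sup>a \<le> C M\<^bsup>q/p - 1\<^esup> G d\<^sup>b\<close> (\<open>local_oscillation\<close>), which is integrated over the domain.

The global part \<open>|m y - m 0|\<close> is summed along a chain of balls centred on the curve of \<open>y\<close>. Each
centre is the last point of the curve in the closed ball around the previous centre. Hence the
centres are separated, the balls overlap boundedly often, and each ball but the last takes a
parameter time at least proportional to its radius. A weight \<open>d\<^bsup>1 - 1/\<beta> + \<epsilon>\<^esup>\<close> is summable along the chain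
(\<open>chain_sum_bdist\<close>), since \<open>d\<close> is at least a multiple of \<open>t\<^sup>\<beta>\<close> at time \<open>t\<close>. Hoelder's inequality with
this weight bounds \<open>|m y - m 0|\<^sup>p\<close> by the integral of \<open>G d\<^sup>\<tau>\<close> with
\<open>\<tau> = s p - n - (1 - 1/\<beta> + \<epsilon>)(p - 1)\<close> over the points \<open>x\<close> with \<open>|x - y| \<le> L (d x)\<^bsup>1/\<beta>\<^esup>\<close>
(\<open>curve_chain_estimate\<close>). Jensen's inequality for the exponent \<open>q/p\<close> and Tonelli's theorem then
reduce the estimate to the volume of the ball of radius \<open>L (d x)\<^bsup>1/\<beta>\<^esup>\<close>, on which \<open>d\<^sup>a\<close> is at most a
multiple of \<open>(d x)\<^bsup>a/\<beta>\<^esup>\<close> (\<open>shadow_operator_bound\<close>). The powers of \<open>d\<close> add up to a nonnegative exponent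
for small \<open>\<epsilon>\<close> exactly when the strict inequality for \<open>b\<close> holds.

The local argument needs \<open>s p < n\<close>. If \<open>s p \<ge> n\<close>, then \<open>s\<close> is lowered to some \<open>s'\<close> and \<open>b\<close> to
\<open>b - (s - s') p\<close>: this preserves the hypothesis on \<open>b\<close>, and increases the energy by at most a
constant factor because \<open>|z - x| \<le> d x / 2\<close> (\<open>energy_le_double_integral\<close>).\<close>

section \<open>Inequalities for real powers\<close>

text \<open>The graph of \<open>t \<mapsto> t\<^sup>r\<close> lies above its tangent at \<open>m\<close>; this is the linearisation behind Jensen's
inequality below.\<close>

lemma powr_tangent_line:
  fixes k m r :: real
  assumes "r \<ge> 1" "k \<ge> 0" "m \<ge> 0"
  shows "r * m powr (r - 1) * k \<le> k powr r + (r - 1) * m powr r"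
proof (cases "r = 1 \<or> m = 0 \<or> k = 0")
  case True
  then show ?thesis using assms by (auto simp: powr_def)
next
  case False
  then have r: "r > 1" and m: "m > 0" and k: "k > 0" using assms by auto
  \<comment> \<open>Young's inequality with the conjugate exponents r and r / (r - 1)\<close>
  have "k powr 1 * m powr (r - 1) = (k powr r) powr (1/r) * (m powr r) powr (1 - 1/r)"
    using r by (simp add: powr_powr) (simp add: right_diff_distrib)
  also have "\<dots> \<le> (1/r) * k powr r + (1 - 1/r) * m powr r"
    by (rule Youngs_inequality_0) (use r m k in \<open>auto simp: field_simps\<close>)
  finally show ?thesis using r assms by (simp add: field_simps)
qed

lemma powr_comparable:
  fixes u v A e :: real
  assumes "0 < u" "0 < v" "u \<le> A * v" "v \<le> A * u"
  shows "u powr e \<le> A powr \<bar>e\<bar> * v powr e"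
proof -
  have A: "A > 0" using assms by (smt (verit) mult_nonpos_nonneg mult_pos_pos zero_less_mult_pos2)
  show ?thesis
  proof (cases "e \<ge> 0")
    case True
    then have "u powr e \<le> (A * v) powr e" using assms by (intro powr_mono2) auto
    then show ?thesis using True A assms by (simp add: powr_mult)
  next
    case False
    have "(A * u) powr e \<le> v powr e" using assms False by (intro powr_mono2') auto
    then have "A powr (-e) * (A powr e * u powr e) \<le> A powr (-e) * v powr e"
      using A assms by (intro mult_left_mono) (auto simp: powr_mult)
    then show ?thesis using False A by (simp add: mult.assoc[symmetric] powr_add[symmetric])
  qed
qed

lemma powr_sum_le:
  fixes u v q :: real
  assumes "0 \<le> u" "0 \<le> v" "0 \<le> q"
  shows "(u + v) powr q \<le> 2 powr q * (u powr q + v powr q)"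
proof -
  have "(u + v) powr q \<le> (2 * max u v) powr q" using assms by (intro powr_mono2) auto
  also have "\<dots> = 2 powr q * (max u v) powr q" using assms by (simp add: powr_mult)
  also have "\<dots> \<le> 2 powr q * (u powr q + v powr q)" by (intro mult_left_mono) (auto simp: max_def)
  finally show ?thesis .
qed

text \<open>By concavity of \<open>t \<mapsto> t\<^sup>e\<close>, the increment over an interval dominates the interval length times the
derivative at the right end point. Summed over a partition it compares a Riemann sum of the singular
function \<open>t\<^bsup>e - 1\<^esup>\<close> with a telescoping sum.\<close>

lemma Bernoulli_powr_step:
  fixes u t e :: real
  assumes "0 \<le> u" "u \<le> t" "0 < t" "0 < e" "e \<le> 1"
  shows "e * (t powr (e - 1) * (t - u)) \<le> t powr e - u powr e"
proof -
  have "t powr (e - 1) * t = t powr e" using assms by (simp add: powr_diff)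
  moreover have "(u powr e) \<le> e * (t powr (e-1) * u) + (1 - e) * t powr e"
  proof (cases "u = 0")
    case False
    have "u powr e = t powr (e - 1) * (u powr e * t powr (1 - e))"
      using assms by (simp add: powr_diff)
    also have "\<dots> \<le> t powr (e - 1) * (e * u + (1 - e) * t)"
      using Youngs_inequality_0[of e "1-e" u t] False assms by (intro mult_left_mono) auto
    also have "\<dots> = e * (t powr (e-1) * u) + (1 - e) * (t powr (e - 1) * t)"
      by (simp add: algebra_simps)
    finally show ?thesis using assms by (simp add: powr_diff)
  qed (use assms in \<open>simp\<close>)
  ultimately show ?thesis by (simp add: algebra_simps)
qed

section \<open>Jensen's inequality for weighted integrals\<close>

text \<open>Integrating the tangent inequality at \<open>m = I / W\<close> gives Jensen's inequality, which for \<open>W \<noteq> 1\<close> is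
Hoelder's inequality for the weight \<open>w\<close>. The integral of \<open>k w\<close> enters only through real lower bounds
\<open>I\<close>, so that an infinite integral does not have to be treated separately. The lemma is used for means
over balls, for sums along a chain, and for passing from the exponent \<open>p\<close> to \<open>q\<close>.\<close>

lemma nn_integral_jensen_powr:
  fixes k :: "'b \<Rightarrow> real" and w :: "'b \<Rightarrow> ennreal" and I W r :: real
  assumes [measurable]: "k \<in> borel_measurable M" "w \<in> borel_measurable M"
    and k: "\<And>x. x \<in> space M \<Longrightarrow> k x \<ge> 0" and r: "r \<ge> 1"
    and W: "W > 0" "(\<integral>\<^sup>+x. w x \<partial>M) \<le> ennreal W"
    and I: "I \<ge> 0" "ennreal I \<le> (\<integral>\<^sup>+x. ennreal (k x) * w x \<partial>M)"
  shows "ennreal (I powr r) \<le> ennreal (W powr (r - 1)) * (\<integral>\<^sup>+x. ennreal (k x powr r) * w x \<partial>M)"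
proof -
  define X where "X = (\<integral>\<^sup>+x. ennreal (k x powr r) * w x \<partial>M)"
  define m where "m = I / W"
  have m: "m \<ge> 0" using I W by (simp add: m_def)
  have "ennreal (r * m powr (r - 1)) * ennreal I
      \<le> ennreal (r * m powr (r - 1)) * (\<integral>\<^sup>+x. ennreal (k x) * w x \<partial>M)"
    by (rule mult_left_mono[OF I(2)]) simp
  also have "\<dots> = (\<integral>\<^sup>+x. ennreal (r * m powr (r - 1) * k x) * w x \<partial>M)"
    using r k by (subst nn_integral_cmult[symmetric])
      (auto intro!: nn_integral_cong simp: ennreal_mult mult.assoc)
  also have "\<dots> \<le> (\<integral>\<^sup>+x. ennreal (k x powr r + (r - 1) * m powr r) * w x \<partial>M)"
    using powr_tangent_line[OF r k m]
    by (intro nn_integral_mono mult_right_mono ennreal_leI) auto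
  also have "\<dots> = X + ennreal ((r - 1) * m powr r) * (\<integral>\<^sup>+x. w x \<partial>M)"
    using r by (simp add: X_def ennreal_plus distrib_right nn_integral_add nn_integral_cmult)
  also have "\<dots> \<le> X + ennreal ((r - 1) * m powr r) * ennreal W"
    by (intro add_left_mono mult_left_mono W) simp
  also have "\<dots> = X + ennreal ((r - 1) * m powr r * W)"
    using r W by (simp add: ennreal_mult)
  finally have *: "ennreal (r * m powr (r - 1) * I) \<le> X + ennreal ((r - 1) * m powr r * W)"
    using r I by (simp add: ennreal_mult)
  have e: "m powr (r - 1) * I = m powr r * W"
    using W I by (cases "I = 0") (auto simp: m_def powr_diff)
  have "r * m powr (r - 1) * I = m powr r * W + (r - 1) * m powr r * W"
    using e by (simp add: algebra_simps)
  then have "ennreal (m powr r * W) + ennreal ((r - 1) * m powr r * W) \<le> X + ennreal ((r - 1) * m powr r * W)"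
    using * r W by (simp add: ennreal_plus[symmetric] del: ennreal_plus)
  then have X: "ennreal (m powr r * W) \<le> X"
    by (simp add: ennreal_add_left_cancel_le add.commute)
  have "I powr r = W powr (r - 1) * (m powr r * W)"
    using W I by (simp add: m_def powr_divide powr_diff)
  then have "ennreal (I powr r) = ennreal (W powr (r - 1)) * ennreal (m powr r * W)"
    using W by (simp add: ennreal_mult)
  also have "\<dots> \<le> ennreal (W powr (r - 1)) * X"
    by (rule mult_left_mono[OF X]) simp
  finally show ?thesis by (simp add: X_def)
qed

section \<open>Curves with almost everywhere bounded speed\<close>

text \<open>Otherwise \<open>\<psi> x = \<phi> x - (K + e) x\<close> increases from \<open>u\<close> to \<open>t\<close> for a small \<open>e > 0\<close>. A Lipschitz function
maps null sets to null sets, so some level \<open>c\<close> strictly between the end values is not attained on \<open>N\<close>.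
At the last point of \<open>[u, t]\<close> with \<open>\<psi> \<le> c\<close> the function is differentiable with derivative at most \<open>-e\<close>,
which contradicts \<open>\<psi> > c\<close> afterwards.\<close>

lemma Lipschitz_AE_derivative_bound:
  fixes \<phi> :: "real \<Rightarrow> real"
  assumes lip: "L-lipschitz_on {0..1} \<phi>"
    and N: "negligible N"
    and der: "\<And>t. t \<in> {0..1} - N \<Longrightarrow> \<exists>v\<le>K. (\<phi> has_real_derivative v) (at t within {0..1})"
    and u: "0 \<le> u" "u \<le> t" "t \<le> 1"
  shows "\<phi> t - \<phi> u \<le> K * (t - u)"
proof (rule ccontr)
  assume "\<not> ?thesis"
  then have gt: "\<phi> t - \<phi> u > K * (t - u)" by simp
  then have ut: "u < t" using u by (cases "u = t") auto
  \<comment> \<open>half of the excess slope, so that the slope K + e is still exceeded\<close>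
  define e where "e = (\<phi> t - \<phi> u - K * (t - u)) / (2 * (t - u))"
  have e: "e > 0" using gt ut by (simp add: e_def)
  define \<psi> where "\<psi> x = \<phi> x - (K + e) * x" for x
  have et: "e * (t - u) = (\<phi> t - \<phi> u - K * (t - u)) / 2" using ut by (simp add: e_def divide_simps)
  have lt: "\<psi> u < \<psi> t" using et gt unfolding \<psi>_def
    by (simp add: algebra_simps add_divide_distrib diff_divide_distrib)
  have cont\<phi>: "continuous_on {0..1} \<phi>" using lip by (rule lipschitz_on_continuous_on)
  then have cont: "continuous_on {0..1} \<psi>" unfolding \<psi>_def by (intro continuous_intros)
  have "negligible (\<psi> ` (N \<inter> {0..1}))"
  proof (rule negligible_locally_Lipschitz_image)
    show "negligible (N \<inter> {0..1})" using N by (auto intro: negligible_subset) 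
    fix x assume x: "x \<in> N \<inter> {0..1}"
    have "norm (\<psi> y - \<psi> x) \<le> (L + \<bar>K + e\<bar>) * norm (y - x)" if "y \<in> N \<inter> {0..1}" for y
    proof -
      have "\<psi> y - \<psi> x = (\<phi> y - \<phi> x) - (K + e) * (y - x)" by (simp add: \<psi>_def algebra_simps)
      then have "norm (\<psi> y - \<psi> x) \<le> norm (\<phi> y - \<phi> x) + \<bar>K + e\<bar> * norm (y - x)"
        by (metis norm_triangle_ineq4 norm_mult real_norm_def)
      moreover have "norm (\<phi> y - \<phi> x) \<le> L * norm (y - x)"
        using lipschitz_onD[OF lip, of y x] x that by (simp add: dist_norm)
      ultimately show ?thesis by (simp add: algebra_simps)
    qed
    then show "\<exists>T B. open T \<and> x \<in> T \<and> (\<forall>y\<in>N \<inter> {0..1} \<inter> T. norm (\<psi> y - \<psi> x) \<le> B * norm (y - x))"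
      by (intro exI[of _ UNIV] exI[of _ "L + \<bar>K + e\<bar>"]) auto
  qed simp
  moreover have "\<not> negligible {\<psi> u<..<\<psi> t}"
    using lt negligible_interval(2)[of "\<psi> u" "\<psi> t"] by (simp add: box_real)
  ultimately obtain c where c: "\<psi> u < c" "c < \<psi> t" "c \<notin> \<psi> ` (N \<inter> {0..1})"
    by (meson greaterThanLessThan_iff negligible_subset subsetI)
  define S where "S = {x \<in> {u..t}. \<psi> x \<le> c}"
  have contut: "continuous_on {u..t} \<psi>" using cont u by (auto intro: continuous_on_subset)
  have "S = {u..t} \<inter> \<psi> -` {..c}" by (auto simp: S_def)
  then have "closed S" using continuous_closed_preimage[OF contut, of "{..c}"] by simp
  then have "compact S" unfolding compact_eq_bounded_closed
    by (auto simp: S_def intro: bounded_subset[of "{u..t}"])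
  moreover have "S \<noteq> {}" using c ut unfolding S_def by (auto intro!: exI[of _ u])
  ultimately obtain x where x: "x \<in> S" "\<And>y. y \<in> S \<Longrightarrow> y \<le> x"
    using compact_attains_sup[of S] by blast
  have xt: "x < t" using x c by (auto simp: S_def less_le)
  have above: "\<psi> y > c" if "x < y" "y \<le> t" for y
    using x(2)[of y] x(1) that by (force simp: S_def)
  have xc: "\<psi> x = c"
  proof (rule ccontr)
    assume "\<psi> x \<noteq> c"
    then have "\<psi> x < c" using x by (auto simp: S_def)
    moreover have "continuous_on {x..t} \<psi>" using contut x by (auto simp: S_def intro: continuous_on_subset)
    ultimately obtain y where "x \<le> y" "y \<le> t" "\<psi> y = c" using IVT'[of \<psi> x c t] c xt by force
    then show False using above[of y] \<open>\<psi> x < c\<close> by (cases "x = y") auto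
  qed
  have "x \<in> {0..1}" using x(1) u by (auto simp: S_def)
  moreover from this have "x \<notin> N" using xc c(3) by blast
  ultimately obtain v where v: "v \<le> K" "(\<phi> has_real_derivative v) (at x within {0..1})" using der by blast
  have "((\<lambda>x. \<phi> x - (K + e) * x) has_real_derivative (v - (K + e))) (at x within {0..1})"
    using v(2) by (auto intro!: derivative_eq_intros)
  then have "(\<psi> has_real_derivative (v - (K + e))) (at x within {0..1})" by (simp add: \<psi>_def[abs_def])
  then obtain d where d: "d > 0" "\<And>h. h > 0 \<Longrightarrow> x + h \<in> {0..1} \<Longrightarrow> h < d \<Longrightarrow> \<psi> x > \<psi> (x + h)"
    using has_real_derivative_neg_dec_right[of \<psi> "v - (K+e)" x "{0..1}"] v(1) e by auto
  define h where "h = min (d/2) (t - x)"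
  have h: "h > 0" "h < d" "x + h \<le> t" using d xt by (auto simp: h_def min_def)
  then have "\<psi> (x + h) < c" using d(2)[of h] xc x(1) u by (auto simp: S_def)
  then show False using above[of "x + h"] h by auto
qed

lemma speed_bounded_lipschitz:
  fixes g :: "real \<Rightarrow> 'a::euclidean_space"
  assumes "speed_bounded g K" "K > 0"
  shows "K-lipschitz_on {0..1} g"
proof -
  obtain L where L: "L-lipschitz_on {0..1} g" using assms by (auto simp: speed_bounded_def)
  obtain N where N: "N \<in> null_sets lborel"
    and der: "\<And>t. t \<in> {0..1} - N \<Longrightarrow> \<exists>v. (g has_vector_derivative v) (at t within {0..1}) \<and> norm v \<le> K"
    using assms(1) unfolding speed_bounded_def by (auto elim!: AE_E3 simp: eventually_ae_filter) blast
  have negl: "negligible N"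
    using N by (auto simp: negligible_iff_null_sets intro: null_sets_completionI)
  have *: "norm (g t - g u) \<le> K * (t - u)" if u: "0 \<le> u" "u \<le> t" "t \<le> 1" for u t
  proof (cases "g t = g u")
    case False
    \<comment> \<open>reduction to the component in the direction of the increment\<close>
    define e where "e = (g t - g u) /\<^sub>R norm (g t - g u)"
    have ne: "norm e = 1" using False by (simp add: e_def)
    have "g t \<bullet> e - g u \<bullet> e \<le> K * (t - u)"
    proof (rule Lipschitz_AE_derivative_bound[OF _ negl _ u])
      show "L-lipschitz_on {0..1} (\<lambda>x. g x \<bullet> e)"
      proof (rule lipschitz_onI)
        fix x y :: real assume xy: "x \<in> {0..1}" "y \<in> {0..1}"
        have "dist (g x \<bullet> e) (g y \<bullet> e) = \<bar>(g x - g y) \<bullet> e\<bar>" by (simp add: dist_real_def inner_diff_left)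
        also have "\<dots> \<le> norm (g x - g y) * norm e" by (rule Cauchy_Schwarz_ineq2)
        also have "\<dots> \<le> L * dist x y" using lipschitz_onD[OF L xy] ne by (simp add: dist_norm)
        finally show "dist (g x \<bullet> e) (g y \<bullet> e) \<le> L * dist x y" .
      qed (use L in \<open>rule lipschitz_on_nonneg\<close>)
      fix x assume "x \<in> {0..1} - N"
      then obtain v where v: "(g has_vector_derivative v) (at x within {0..1})" "norm v \<le> K"
        using der by blast
      have "((\<lambda>x. g x \<bullet> e) has_real_derivative (v \<bullet> e)) (at x within {0..1})"
        unfolding has_real_derivative_iff_has_vector_derivative
        using bounded_linear.has_vector_derivative[OF bounded_linear_inner_left v(1)] .
      moreover have "v \<bullet> e \<le> K" using norm_cauchy_schwarz[of v e] ne v(2) by simp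
      ultimately show "\<exists>v\<le>K. ((\<lambda>x. g x \<bullet> e) has_real_derivative v) (at x within {0..1})" by blast
    qed
    moreover have "g t \<bullet> e - g u \<bullet> e = norm (g t - g u)"
      using False by (simp add: e_def inner_diff_left[symmetric] right_diff_distrib[symmetric]
          power2_norm_eq_inner[symmetric] power2_eq_square)
    ultimately show ?thesis by simp
  qed (use assms u in simp)
  show ?thesis
  proof (rule lipschitz_onI)
    fix x y :: real assume "x \<in> {0..1}" "y \<in> {0..1}"
    then show "dist (g x) (g y) \<le> K * dist x y"
      using *[of x y] *[of y x] by (cases "x \<le> y") (auto simp: dist_norm norm_minus_commute)
  qed (use assms in simp)
qed

section \<open>Fractional energy and means over balls\<close>

text \<open>The power of the distance to the boundary is left out here; it is comparable to \<open>d x\<^sup>b\<close> on the domain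
of integration and enters as a separate factor.\<close>

definition fractional_energy ::
  "'a::euclidean_space set \<Rightarrow> real \<Rightarrow> real \<Rightarrow> ('a \<Rightarrow> real) \<Rightarrow> 'a \<Rightarrow> ennreal" where
  "fractional_energy \<Omega> s p f x =
     (\<integral>\<^sup>+z\<in>cball x (bdist \<Omega> x / 2).
        ennreal (\<bar>f z - f x\<bar> powr p / norm (z - x) powr (real DIM('a) + s * p)) \<partial>lborel)"

definition ball_mean :: "('a::euclidean_space \<Rightarrow> real) \<Rightarrow> 'a \<Rightarrow> real \<Rightarrow> real" where
  "ball_mean f x r = (LINT u:ball x r|lborel. f u) / measure lborel (ball x r)"

abbreviation unit_vol :: "'a::euclidean_space itself \<Rightarrow> real" where
  "unit_vol _ \<equiv> unit_ball_vol (real DIM('a))"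

lemma measure_ball_powr:
  fixes x :: "'a::euclidean_space"
  assumes "r > 0"
  shows "measure lborel (ball x r) = unit_vol TYPE('a) * r powr real DIM('a)"
  using assms by (simp add: content_ball powr_realpow)

lemma emeasure_ball_powr:
  fixes x :: "'a::euclidean_space"
  assumes "r > 0"
  shows "emeasure lborel (ball x r) = ennreal (unit_vol TYPE('a) * r powr real DIM('a))"
  using assms by (simp add: emeasure_ball powr_realpow)

lemma measurable_ball [measurable]:
  fixes x :: "'a::euclidean_space"
  shows "ball x r \<in> sets borel"
  by simp

lemma measurable_cball [measurable]:
  fixes x :: "'a::euclidean_space"
  shows "cball x r \<in> sets borel"
  by simp

text \<open>Jensen's inequality for the normalised Lebesgue measure on the ball. Continuity on the closed ball
makes the mean a genuine Lebesgue integral.\<close>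

lemma ball_mean_jensen:
  fixes f :: "'a::euclidean_space \<Rightarrow> real"
  assumes [measurable]: "f \<in> borel_measurable borel" and cont: "continuous_on (cball x r) f"
    and r: "r > 0" and p: "p \<ge> 1"
  shows "ennreal (\<bar>c - ball_mean f x r\<bar> powr p) \<le>
    ennreal (1 / (unit_vol TYPE('a) * r powr real DIM('a))) * (\<integral>\<^sup>+u\<in>ball x r. ennreal (\<bar>c - f u\<bar> powr p) \<partial>lborel)"
proof -
  define V where "V = unit_vol TYPE('a) * r powr real DIM('a)"
  have V: "V > 0" "measure lborel (ball x r) = V" "emeasure lborel (ball x r) = ennreal V"
    using r by (auto simp: V_def measure_ball_powr emeasure_ball_powr simp del: content_ball)
  have intc: "set_integrable lborel (cball x r) f"
    unfolding set_integrable_def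
    by (rule borel_integrable_compact) (use cont in auto)
  then have int: "set_integrable lborel (ball x r) f"
    by (rule set_integrable_subset) auto
  have intk: "set_integrable lborel (ball x r) (\<lambda>u. c)"
    using V by (auto simp: set_integrable_def intro!: integrable_real_mult_indicator)
  have "V * \<bar>c - ball_mean f x r\<bar> = \<bar>V * c - (LINT u:ball x r|lborel. f u)\<bar>"
  proof -
    have "V * \<bar>c - ball_mean f x r\<bar> = \<bar>V * (c - ball_mean f x r)\<bar>" using V by (simp add: abs_mult)
    then show ?thesis using V by (simp add: ball_mean_def right_diff_distrib)
  qed
  also have "V * c - (LINT u:ball x r|lborel. f u) = (LINT u:ball x r|lborel. c - f u)"
    using V by (subst set_integral_diff(2)[OF intk int]) (simp add: set_lebesgue_integral_def)
  also have "ennreal \<bar>LINT u:ball x r|lborel. c - f u\<bar> \<le> (\<integral>\<^sup>+u. norm (indicator (ball x r) u *\<^sub>R (c - f u)) \<partial>lborel)"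
    unfolding set_lebesgue_integral_def
    using integral_norm_bound_ennreal[of lborel "\<lambda>u. indicator (ball x r) u *\<^sub>R (c - f u)"]
      set_integral_diff(1)[OF intk int] by (simp add: set_integrable_def)
  also have "\<dots> = (\<integral>\<^sup>+u. ennreal \<bar>c - f u\<bar> * indicator (ball x r) u \<partial>lborel)"
    by (intro nn_integral_cong) (auto simp: indicator_def)
  finally have I: "ennreal (V * \<bar>c - ball_mean f x r\<bar>) \<le> (\<integral>\<^sup>+u. ennreal \<bar>c - f u\<bar> * indicator (ball x r) u \<partial>lborel)" .
  have "ennreal ((V * \<bar>c - ball_mean f x r\<bar>) powr p) \<le> ennreal (V powr (p - 1)) *
      (\<integral>\<^sup>+u. ennreal (\<bar>c - f u\<bar> powr p) * indicator (ball x r) u \<partial>lborel)"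
    by (rule nn_integral_jensen_powr[OF _ _ _ p V(1) _ _ I]) (use V in auto)
  then have "ennreal (1 / V powr p) * ennreal ((V * \<bar>c - ball_mean f x r\<bar>) powr p) \<le>
      ennreal (1 / V powr p) * (ennreal (V powr (p - 1)) *
      (\<integral>\<^sup>+u. ennreal (\<bar>c - f u\<bar> powr p) * indicator (ball x r) u \<partial>lborel))"
    by (rule mult_left_mono) simp
  also have "ennreal (1 / V powr p) * ennreal ((V * \<bar>c - ball_mean f x r\<bar>) powr p) = ennreal (\<bar>c - ball_mean f x r\<bar> powr p)"
    using V by (simp add: ennreal_mult[symmetric] powr_mult)
  also have "ennreal (1 / V powr p) * (ennreal (V powr (p - 1)) * X) = ennreal (1 / V) * X" for X
    using V by (simp add: mult.assoc[symmetric] ennreal_mult[symmetric] powr_diff)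
  finally show ?thesis by (simp add: V_def)
qed

section \<open>Distance to the boundary\<close>

locale bounded_domain =
  fixes \<Omega> :: "'a::euclidean_space set"
  assumes open_domain: "open \<Omega>" and bounded: "bounded \<Omega>" and nonempty: "\<Omega> \<noteq> {}"
begin

abbreviation d :: "'a \<Rightarrow> real" where "d \<equiv> bdist \<Omega>"

lemma frontier_nonempty: "frontier \<Omega> \<noteq> {}"
  using nonempty bounded frontier_eq_empty[of \<Omega>] not_bounded_UNIV[where 'a='a] by auto

lemma bdist_nonneg: "d x \<ge> 0"
  by (simp add: bdist_def infdist_nonneg)

lemma bdist_pos: "x \<in> \<Omega> \<Longrightarrow> d x > 0"
  unfolding bdist_def using open_domain frontier_nonempty
  by (intro infdist_pos_not_in_closed) (auto simp: frontier_def interior_open)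

lemma bdist_triangle: "d x \<le> d y + dist x y"
  by (simp add: bdist_def infdist_triangle)

lemma continuous_bdist: "continuous_on UNIV d"
  unfolding bdist_def by (intro continuous_intros)

lemma measurable_bdist [measurable]: "d \<in> borel_measurable borel"
  by (rule borel_measurable_continuous_onI[OF continuous_bdist])

lemma measurable_domain [measurable]: "\<Omega> \<in> sets borel"
  using open_domain by simp

text \<open>A ball that meets both the open set and its complement meets the frontier, by connectedness.\<close>

lemma ball_bdist_subset:
  assumes "x \<in> \<Omega>" shows "ball x (d x) \<subseteq> \<Omega>"
proof (rule ccontr)
  assume "\<not> ?thesis"
  then have "ball x (d x) \<inter> frontier \<Omega> \<noteq> {}"
    using assms bdist_pos[OF assms] centre_in_ball[of x "d x"]
    by (intro connected_Int_frontier) (blast intro: connected_ball)+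
  then obtain w where "w \<in> frontier \<Omega>" "dist x w < d x" by auto
  then show False using infdist_le[of w "frontier \<Omega>" x] by (simp add: bdist_def)
qed

lemma cball_bdist_subset:
  assumes "x \<in> \<Omega>" "r < d x" shows "cball x r \<subseteq> \<Omega>"
  using ball_bdist_subset[OF assms(1)] assms(2) by force

lemma bdist_bounded: "\<exists>D\<ge>1. \<forall>x\<in>\<Omega>. d x \<le> D"
proof -
  obtain w where w: "w \<in> frontier \<Omega>" using frontier_nonempty by auto
  obtain D where D: "\<And>x. x \<in> \<Omega> \<Longrightarrow> dist w x \<le> D" using bounded bounded_any_center[of \<Omega> w] by auto
  show ?thesis
  proof (intro exI[of _ "max 1 D"] conjI ballI)
    fix x assume "x \<in> \<Omega>"
    then show "d x \<le> max 1 D" using infdist_le[OF w, of x] D[of x] by (simp add: bdist_def dist_commute)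
  qed simp
qed

lemma measurable_fractional_energy [measurable]:
  assumes [measurable]: "f \<in> borel_measurable borel"
  shows "fractional_energy \<Omega> s p f \<in> borel_measurable borel"
proof -
  have [measurable]: "Measurable.pred (borel \<Otimes>\<^sub>M borel) (\<lambda>w. snd w \<in> cball (fst w) (d (fst w) / 2))"
    unfolding mem_cball by measurable
  have "(\<lambda>x. \<integral>\<^sup>+z. ennreal (\<bar>f z - f x\<bar> powr p / norm (z - x) powr (real DIM('a) + s * p))
      * indicator (cball x (d x / 2)) z \<partial>lborel) \<in> borel_measurable borel"
    by (rule lborel.borel_measurable_nn_integral) (simp add: indicator_def split_beta, measurable)
  then show ?thesis by (simp add: fractional_energy_def[abs_def])
qed

section \<open>Oscillation of means\<close>

text \<open>On \<open>cball x r\<close> the kernel \<open>|u - x|\<^bsup>-(n + s p)\<^esup>\<close> is at least \<open>r\<^bsup>-(n + s p)\<^esup>\<close>, so that the mean of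
\<open>|f x - f u|\<^sup>p\<close> is bounded by the energy at \<open>x\<close>. The centre \<open>x'\<close> of the averaging ball may differ from \<open>x\<close>;
this form also serves the comparison of two means.\<close>

lemma pointwise_mean_oscillation:
  assumes f [measurable]: "f \<in> borel_measurable borel" and cont: "continuous_on \<Omega> f"
    and x: "x \<in> \<Omega>" and r: "0 < r" "r \<le> d x / 2" and p: "p \<ge> 1" and s: "s > 0"
    and sub: "ball x' r' \<subseteq> cball x r" and x': "x' \<in> \<Omega>" "0 < r'" "r' < d x'"
  shows "ennreal (\<bar>f x - ball_mean f x' r'\<bar> powr p) \<le>
    ennreal (r powr (real DIM('a) + s * p) / (unit_vol TYPE('a) * r' powr real DIM('a)))
      * fractional_energy \<Omega> s p f x"
proof -
  define V where "V = unit_vol TYPE('a) * r' powr real DIM('a)"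
  have V: "V > 0" using x' by (simp add: V_def)
  define R where "R = r powr (real DIM('a) + s * p)"
  have cont': "continuous_on (cball x' r') f"
    using continuous_on_subset[OF cont cball_bdist_subset[OF x'(1) x'(3)]] .
  have "ennreal (\<bar>f x - ball_mean f x' r'\<bar> powr p) \<le>
      ennreal (1 / V) * (\<integral>\<^sup>+u\<in>ball x' r'. ennreal (\<bar>f x - f u\<bar> powr p) \<partial>lborel)"
    unfolding V_def by (rule ball_mean_jensen[OF f cont' x'(2) p])
  also have "(\<integral>\<^sup>+u\<in>ball x' r'. ennreal (\<bar>f x - f u\<bar> powr p) \<partial>lborel) \<le>
     (\<integral>\<^sup>+u. ennreal R * (ennreal (\<bar>f u - f x\<bar> powr p / norm (u - x) powr (real DIM('a) + s * p))
        * indicator (cball x (d x / 2)) u) \<partial>lborel)"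
  proof (rule nn_integral_mono)
    fix u :: 'a
    show "ennreal (\<bar>f x - f u\<bar> powr p) * indicator (ball x' r') u \<le>
      ennreal R * (ennreal (\<bar>f u - f x\<bar> powr p / norm (u - x) powr (real DIM('a) + s * p))
        * indicator (cball x (d x / 2)) u)"
    proof (cases "u \<in> ball x' r' \<and> u \<noteq> x")
      case True
      then have "u \<in> cball x r" using sub by blast
      then have ux: "norm (u - x) \<le> r" by (simp add: dist_norm norm_minus_commute)
      define N where "N = norm (u - x) powr (real DIM('a) + s * p)"
      have N: "0 < N" "N \<le> R" unfolding N_def R_def using True ux s p by (auto intro!: powr_mono2)
      have "\<bar>f x - f u\<bar> powr p \<le> R * (\<bar>f u - f x\<bar> powr p / N)"
        using N mult_left_mono[OF N(2), of "\<bar>f u - f x\<bar> powr p"]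
        by (simp add: field_simps abs_minus_commute)
      moreover have "u \<in> cball x (d x / 2)" using ux r by (simp add: dist_norm norm_minus_commute)
      moreover have "R \<ge> 0" by (simp add: R_def)
      ultimately show ?thesis using True N
        by (simp add: N_def[symmetric] ennreal_mult[symmetric] ennreal_leI)
    qed (auto simp: indicator_def)
  qed
  also have "\<dots> = ennreal R * fractional_energy \<Omega> s p f x"
  proof -
    have "(\<lambda>u. ennreal (\<bar>f u - f x\<bar> powr p / norm (u - x) powr (real DIM('a) + s * p))
        * indicator (cball x (d x / 2)) u) \<in> borel_measurable lborel" by measurable
    then show ?thesis by (simp add: fractional_energy_def nn_integral_cmult)
  qed
  also have "ennreal (1 / V) * (ennreal R * fractional_energy \<Omega> s p f x) = ennreal (R / V) * fractional_energy \<Omega> s p f x"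
    using V by (simp add: mult.assoc[symmetric] ennreal_mult[symmetric] R_def)
  finally show ?thesis by (simp add: V_def R_def mult_left_mono)
qed

text \<open>Jensen's inequality over the first ball reduces the claim to the distance between \<open>f u\<close> and the second
mean for \<open>u\<close> in the first ball. The factor 20 leaves room for every point of the second ball to lie
within \<open>d u / 2\<close> of \<open>u\<close>, where the energy at \<open>u\<close> sees it.\<close>

lemma adjacent_means_oscillation:
  assumes p: "p \<ge> 1" and s: "s > 0"
  shows "\<exists>C>0. \<forall>f x x' r r'. f \<in> borel_measurable borel \<longrightarrow> continuous_on \<Omega> f \<longrightarrow>
    x \<in> \<Omega> \<longrightarrow> 0 < r \<longrightarrow> r \<le> d x / 20 \<longrightarrow> r / 2 \<le> r' \<longrightarrow> r' \<le> 2 * r \<longrightarrow> dist x x' \<le> r \<longrightarrow>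
    ennreal (\<bar>ball_mean f x r - ball_mean f x' r'\<bar> powr p) \<le>
    ennreal (C * r powr (s * p - real DIM('a))) * (\<integral>\<^sup>+u\<in>ball x r. fractional_energy \<Omega> s p f u \<partial>lborel)"
proof -
  define n where "n = real DIM('a)"
  define v where "v = unit_vol TYPE('a)"
  have v: "v > 0" by (simp add: v_def)
  define C where "C = 4 powr (n + s * p) * 2 powr n / (v * v)"
  show ?thesis
  proof (intro exI[of _ C] conjI allI impI)
    show "C > 0" using v by (simp add: C_def)
    fix f :: "'a \<Rightarrow> real" and x x' :: 'a and r r' :: real
    assume f [measurable]: "f \<in> borel_measurable borel" and cont: "continuous_on \<Omega> f" and x: "x \<in> \<Omega>"
      and r: "0 < r" "r \<le> d x / 20" and r': "r / 2 \<le> r'" "r' \<le> 2 * r" and xx': "dist x x' \<le> r"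
    let ?G = "fractional_energy \<Omega> s p f"
    have x'\<Omega>: "x' \<in> \<Omega>" using cball_bdist_subset[OF x, of r] xx' r bdist_pos[OF x] by auto
    have r'0: "r' > 0" using r r' by auto
    have dx': "r' < d x'" using bdist_triangle[of x x'] xx' r r' by auto
    define m where "m = ball_mean f x' r'"
    have cont': "continuous_on (cball x r) f"
      using continuous_on_subset[OF cont cball_bdist_subset[OF x, of r]] r by simp
    have "ennreal (\<bar>m - ball_mean f x r\<bar> powr p) \<le>
        ennreal (1 / (v * r powr n)) * (\<integral>\<^sup>+u\<in>ball x r. ennreal (\<bar>m - f u\<bar> powr p) \<partial>lborel)"
      unfolding v_def n_def by (rule ball_mean_jensen[OF f cont' r(1) p])
    also have "(\<integral>\<^sup>+u\<in>ball x r. ennreal (\<bar>m - f u\<bar> powr p) \<partial>lborel) \<le>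
       (\<integral>\<^sup>+u\<in>ball x r. ennreal ((4 * r) powr (n + s * p) / (v * (r / 2) powr n)) * ?G u \<partial>lborel)"
    proof (rule nn_integral_mono)
      fix u :: 'a
      show "ennreal (\<bar>m - f u\<bar> powr p) * indicator (ball x r) u \<le>
        ennreal ((4 * r) powr (n + s * p) / (v * (r / 2) powr n)) * ?G u * indicator (ball x r) u"
      proof (cases "u \<in> ball x r")
        case True
        have u: "u \<in> \<Omega>" using True cball_bdist_subset[OF x, of r] r by auto
        have du: "4 * r \<le> d u / 2" using bdist_triangle[of x u] True r by auto
        \<comment> \<open>4 r bounds r (from u to x) plus r (from x to x') plus r', which is at most 2 r\<close>
        have sub: "ball x' r' \<subseteq> cball u (4 * r)"
        proof
          fix z assume "z \<in> ball x' r'"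
          then show "z \<in> cball u (4 * r)"
            using True xx' r r' dist_triangle[of u z x] dist_triangle[of x z x'] by (auto simp: dist_commute)
        qed
        have "ennreal (\<bar>f u - m\<bar> powr p) \<le>
          ennreal ((4 * r) powr (n + s * p) / (v * r' powr n)) * ?G u"
          unfolding m_def v_def n_def
          by (rule pointwise_mean_oscillation[OF f cont u _ du p s sub x'\<Omega> r'0 dx']) (use r in simp)
        also have "\<dots> \<le> ennreal ((4 * r) powr (n + s * p) / (v * (r / 2) powr n)) * ?G u"
          using v r r' by (intro mult_right_mono ennreal_leI divide_left_mono mult_left_mono powr_mono2)
            (auto simp: n_def)
        finally show ?thesis using True by (simp add: abs_minus_commute)
      qed simp
    qed
    also have "\<dots> = ennreal ((4 * r) powr (n + s * p) / (v * (r / 2) powr n)) * (\<integral>\<^sup>+u\<in>ball x r. ?G u \<partial>lborel)"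
    proof -
      have "(\<lambda>u. ?G u * indicator (ball x r) u) \<in> borel_measurable lborel" by measurable
      then show ?thesis by (simp add: nn_integral_cmult mult.assoc)
    qed
    also have "ennreal (1 / (v * r powr n)) * (ennreal ((4 * r) powr (n + s * p) / (v * (r / 2) powr n)) * X)
       = ennreal (C * r powr (s * p - n)) * X" for X
    proof -
      have "1 / (v * r powr n) * ((4 * r) powr (n + s * p) / (v * (r / 2) powr n)) = C * r powr (s * p - n)"
        using r v by (simp add: C_def powr_mult powr_divide powr_diff powr_add field_simps)
      then show ?thesis using v by (simp add: mult.assoc[symmetric] ennreal_mult[symmetric])
    qed
    finally show "ennreal (\<bar>ball_mean f x r - ball_mean f x' r'\<bar> powr p) \<le>
      ennreal (C * r powr (s * p - real DIM('a))) * (\<integral>\<^sup>+u\<in>ball x r. ?G u \<partial>lborel)"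
      by (simp add: m_def n_def abs_minus_commute mult_left_mono)
  qed
qed

end

section \<open>The local part\<close>

text \<open>Hedberg's optimisation over the radius \<open>\<rho>\<close>. With \<open>k = g d\<^sup>\<beta>\<close> the two terms of the first hypothesis
balance at \<open>\<rho> = (E / k)\<^bsup>1/\<nu>\<^esup>\<close>. If this radius is admissible, it gives the bound; otherwise \<open>k\<close> is at most
a multiple of \<open>E d\<^bsup>-\<nu>\<^esup>\<close> and the second hypothesis is enough. In both cases the surplus power of \<open>d\<close>
is the exponent \<open>a - \<beta> q + s q - \<nu> q + \<nu> p\<close>, which is harmless because \<open>d\<close> is bounded. In the
application \<open>\<nu> = n / p\<close>, \<open>\<beta> = b / p\<close>, \<open>E = M\<^bsup>1/p\<^esup>\<close> and \<open>g = (G y)\<^bsup>1/p\<^esup>\<close>.\<close>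

lemma Hedberg_interpolation:
  fixes s p q a \<nu> \<beta> D A :: real
  assumes par: "0 < s" "s < \<nu>" "0 < p" "p \<le> q" "q * (\<nu> - s) \<le> \<nu> * p" "D > 0" "A > 0"
    and e: "a - \<beta> * q + s * q - \<nu> * q + \<nu> * p \<ge> 0"
  shows "\<exists>C>0. \<forall>h g E d. 0 \<le> h \<longrightarrow> 0 \<le> g \<longrightarrow> 0 < E \<longrightarrow> 0 < d \<longrightarrow> d \<le> D \<longrightarrow>
    (\<forall>\<rho>. 0 < \<rho> \<longrightarrow> \<rho> \<le> d / 20 \<longrightarrow> h \<le> A * (\<rho> powr s * g + d powr (- \<beta>) * E * \<rho> powr (s - \<nu>))) \<longrightarrow>
    h \<le> A * (d powr s * g) \<longrightarrow> h powr q * d powr a \<le> C * E powr (q - p) * (g powr p * d powr (\<beta> * p))"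
proof -
  define e where "e = a - \<beta> * q + s * q - \<nu> * q + \<nu> * p"
  have e0: "e \<ge> 0" using assms(8) by (simp add: e_def)
  define lC where "lC = q * \<bar>ln (2 * A)\<bar> + q * \<bar>ln A\<bar> + (q - p) * \<nu> * ln 20 + e * ln D"
  show ?thesis
  proof (intro exI[of _ "exp lC"] conjI allI impI)
    fix h g E d :: real
    assume h: "0 \<le> h" and g: "0 \<le> g" and E: "0 < E" and d: "0 < d" "d \<le> D"
      and H1: "\<forall>\<rho>. 0 < \<rho> \<longrightarrow> \<rho> \<le> d / 20 \<longrightarrow> h \<le> A * (\<rho> powr s * g + d powr (- \<beta>) * E * \<rho> powr (s - \<nu>))"
      and H2: "h \<le> A * (d powr s * g)"
    show "h powr q * d powr a \<le> exp lC * E powr (q - p) * (g powr p * d powr (\<beta> * p))"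
    proof (cases "h = 0")
      case False
      then have h: "h > 0" using h by simp
      then have g: "g > 0" using H2 par g by (cases "g = 0") auto
      \<comment> \<open>in logarithms all the inequalities become linear\<close>
      define x where "x = ln d"
      define lg where "lg = ln g"
      define lE where "lE = ln E"
      define lh where "lh = ln h"
      have ex: "d = exp x" "g = exp lg" "E = exp lE" "h = exp lh"
        using d g E h by (auto simp: x_def lg_def lE_def lh_def)
      have ed: "e * x \<le> e * ln D" using e0 d by (intro mult_left_mono) (auto simp: x_def)
      \<comment> \<open>logarithm of the balancing radius\<close>
      define r where "r = (lE - lg - \<beta> * x) / \<nu>"
      have r: "\<nu> * r = lE - lg - \<beta> * x" using par by (simp add: r_def)
      have "q * lh + a * x \<le> lC + (q - p) * lE + p * lg + \<beta> * p * x"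
      proof (cases "r \<ge> x - ln 20")
        case True
        have "ln h \<le> ln (A * (d powr s * g))" using H2 h by (subst ln_le_cancel_iff) auto
        then have "lh \<le> ln A + s * x + lg"
          using par d g by (simp add: lh_def x_def lg_def ln_mult ln_powr)
        then have 1: "q * lh \<le> q * (ln A + s * x + lg)" using par by (intro mult_left_mono) auto
        have "\<nu> * (x - ln 20) \<le> \<nu> * r" using True par by (intro mult_left_mono) auto
        then have "lg \<le> lE - \<beta> * x - \<nu> * (x - ln 20)" using r by simp
        then have 2: "(q - p) * lg \<le> (q - p) * (lE - \<beta> * x - \<nu> * (x - ln 20))"
          using par by (intro mult_left_mono) auto
        have 3: "q * ln A \<le> q * \<bar>ln A\<bar>" "0 \<le> q * \<bar>ln (2 * A)\<bar>" using par by (auto intro!: mult_left_mono)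
        show ?thesis using 1 2 3 ed unfolding lC_def e_def by (simp add: algebra_simps)
      next
        case False
        have "exp r \<le> exp (x - ln 20)" using False by (subst exp_le_cancel_iff) simp
        also have "\<dots> = d / 20" using ex by (simp add: exp_diff)
        finally have "h \<le> A * (exp r powr s * g + d powr (- \<beta>) * E * exp r powr (s - \<nu>))"
          using H1 by simp
        also have "d powr (- \<beta>) * E * exp r powr (s - \<nu>) = exp (- \<beta> * x + lE + s * r - \<nu> * r)"
          by (simp add: ex powr_def exp_add[symmetric] algebra_simps)
        also have "- \<beta> * x + lE + s * r - \<nu> * r = s * r + lg" using r by simp
        also have "exp r powr s * g = exp (s * r + lg)" by (simp add: ex powr_def exp_add)
        finally have "h \<le> 2 * A * exp (s * r + lg)" by simp
        then have "ln h \<le> ln (2 * A * exp (s * r + lg))" using h par by (subst ln_le_cancel_iff) auto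
        then have "lh \<le> ln (2 * A) + s * r + lg" using par by (simp add: lh_def ln_mult)
        then have 1: "q * lh \<le> q * (ln (2 * A) + s * r + lg)" using par by (intro mult_left_mono) auto
        have lg: "lg = lE - \<nu> * r - \<beta> * x" using r by simp
        have "r \<le> x" using False ln_ge_zero[of "20::real"] by linarith
        then have 2: "(\<nu> * p - q * (\<nu> - s)) * r \<le> (\<nu> * p - q * (\<nu> - s)) * x"
          using par by (intro mult_left_mono) auto
        have 3: "q * ln (2 * A) \<le> q * \<bar>ln (2 * A)\<bar>" "0 \<le> q * \<bar>ln A\<bar>" "0 \<le> (q - p) * \<nu> * ln 20"
          using par by (auto intro!: mult_left_mono)
        show ?thesis using 1 2 3 ed unfolding lC_def e_def lg by (simp add: algebra_simps)
      qed
      then have "exp (q * lh + a * x) \<le> exp (lC + (q - p) * lE + p * lg + \<beta> * p * x)" by simp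
      then show ?thesis by (simp add: ex powr_def exp_add[symmetric] algebra_simps)
    qed auto
  qed simp
qed

context bounded_domain
begin

lemma bdist_in_ball:
  assumes "x \<in> \<Omega>" "r \<le> d x / 20" "u \<in> ball x r"
  shows "u \<in> \<Omega>" "d u \<le> 2 * d x" "d x \<le> 2 * d u" "d u > 0"
proof -
  show "u \<in> \<Omega>" using cball_bdist_subset[of x r] assms bdist_pos[of x] by auto
  then show "d u > 0" by (rule bdist_pos)
  show "d u \<le> 2 * d x" "d x \<le> 2 * d u"
    using bdist_triangle[of u x] bdist_triangle[of x u] assms bdist_pos[of x] by (auto simp: dist_commute)
qed

text \<open>On a small ball the weight is comparable to its value at the centre and can be pulled out.\<close>

lemma energy_on_ball:
  assumes f [measurable]: "f \<in> borel_measurable borel"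
    and M: "(\<integral>\<^sup>+x\<in>\<Omega>. fractional_energy \<Omega> s p f x * ennreal (d x powr b) \<partial>lborel) \<le> ennreal M"
    and x: "x \<in> \<Omega>" "r \<le> d x / 20"
  shows "(\<integral>\<^sup>+u\<in>ball x r. fractional_energy \<Omega> s p f u \<partial>lborel) \<le> ennreal (2 powr \<bar>b\<bar> * d x powr (- b) * M)"
proof -
  let ?G = "fractional_energy \<Omega> s p f"
  let ?c = "2 powr \<bar>b\<bar> * d x powr (- b)"
  have "(\<integral>\<^sup>+u\<in>ball x r. ?G u \<partial>lborel) \<le> (\<integral>\<^sup>+u. ennreal ?c * (?G u * ennreal (d u powr b) * indicator \<Omega> u) \<partial>lborel)"
  proof (rule nn_integral_mono)
    fix u
    show "?G u * indicator (ball x r) u \<le> ennreal ?c * (?G u * ennreal (d u powr b) * indicator \<Omega> u)"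
    proof (cases "u \<in> ball x r")
      case True
      note u = bdist_in_ball[OF x True]
      have "d x powr b \<le> 2 powr \<bar>b\<bar> * d u powr b" using u bdist_pos[OF x(1)] by (intro powr_comparable) auto
      then have "d x powr (- b) * d x powr b \<le> d x powr (- b) * (2 powr \<bar>b\<bar> * d u powr b)"
        by (intro mult_left_mono) auto
      then have "1 \<le> ?c * d u powr b" using bdist_pos[OF x(1)] by (simp add: powr_add[symmetric] mult.assoc mult.left_commute)
      then have "ennreal 1 * ?G u \<le> ennreal (?c * d u powr b) * ?G u" by (intro mult_right_mono ennreal_leI) auto
      then show ?thesis using True u by (simp add: ennreal_mult mult_ac)
    qed simp
  qed
  also have "\<dots> = ennreal ?c * (\<integral>\<^sup>+u\<in>\<Omega>. ?G u * ennreal (d u powr b) \<partial>lborel)"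
    by (intro nn_integral_cmult) measurable
  also have "\<dots> \<le> ennreal ?c * ennreal M" by (intro mult_left_mono M) simp
  finally show ?thesis using M by (simp add: ennreal_mult' )
qed

lemma point_to_mean:
  assumes p: "p \<ge> 1" and s: "s > 0"
  shows "\<exists>A>0. \<forall>f y \<rho> G. f \<in> borel_measurable borel \<longrightarrow> continuous_on \<Omega> f \<longrightarrow> y \<in> \<Omega> \<longrightarrow>
    0 < \<rho> \<longrightarrow> \<rho> \<le> d y / 20 \<longrightarrow> 0 \<le> G \<longrightarrow> fractional_energy \<Omega> s p f y = ennreal G \<longrightarrow>
    \<bar>f y - ball_mean f y \<rho>\<bar> \<le> A * (\<rho> powr s * G powr (1 / p))"
proof -
  define v where "v = unit_vol TYPE('a)"
  have v: "v > 0" by (simp add: v_def)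
  show ?thesis
  proof (intro exI[of _ "(1 / v) powr (1 / p)"] conjI allI impI)
    show "(1 / v) powr (1 / p) > 0" using v by simp
    fix f :: "'a \<Rightarrow> real" and y \<rho> G
    assume f: "f \<in> borel_measurable borel" "continuous_on \<Omega> f" "y \<in> \<Omega>" "0 < \<rho>" "\<rho> \<le> d y / 20" "0 \<le> G"
      "fractional_energy \<Omega> s p f y = ennreal G"
    have "ennreal (\<bar>f y - ball_mean f y \<rho>\<bar> powr p) \<le>
      ennreal (\<rho> powr (real DIM('a) + s * p) / (v * \<rho> powr real DIM('a))) * ennreal G"
      unfolding f(7)[symmetric] v_def
      by (rule pointwise_mean_oscillation) (use f p s bdist_pos[OF f(3)] in auto)
    also have "\<rho> powr (real DIM('a) + s * p) / (v * \<rho> powr real DIM('a)) = (1 / v) * \<rho> powr (s * p)"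
      using f by (simp add: powr_add)
    finally have "\<bar>f y - ball_mean f y \<rho>\<bar> powr p \<le> (1 / v) * \<rho> powr (s * p) * G"
      using v f by (simp add: ennreal_mult[symmetric] del: times_divide_eq_left)
    then have "(\<bar>f y - ball_mean f y \<rho>\<bar> powr p) powr (1 / p) \<le> ((1 / v) * \<rho> powr (s * p) * G) powr (1 / p)"
      using p by (intro powr_mono2) auto
    then show "\<bar>f y - ball_mean f y \<rho>\<bar> \<le> (1 / v) powr (1 / p) * (\<rho> powr s * G powr (1 / p))"
      using p v f by (simp add: powr_mult powr_divide powr_powr mult_ac)
  qed
qed

text \<open>The radius is doubled from \<open>\<rho>\<close> up to \<open>d y / 20\<close>. As \<open>s - n/p < 0\<close>, the errors form a geometric series
that is dominated by the smallest radius. The constant \<open>c\<close> in the proof is the sum of this series,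
characterised by \<open>c = 1 + c 2\<^bsup>s - n/p\<^esup>\<close>; this identity is what carries the induction.\<close>

lemma concentric_means:
  assumes p: "p \<ge> 1" and s: "s > 0" and sp: "s < real DIM('a) / p"
  shows "\<exists>A>0. \<forall>f y \<rho> M. f \<in> borel_measurable borel \<longrightarrow> continuous_on \<Omega> f \<longrightarrow> y \<in> \<Omega> \<longrightarrow>
    0 < \<rho> \<longrightarrow> \<rho> \<le> d y / 20 \<longrightarrow> 0 \<le> M \<longrightarrow>
    (\<integral>\<^sup>+x\<in>\<Omega>. fractional_energy \<Omega> s p f x * ennreal (d x powr b) \<partial>lborel) \<le> ennreal M \<longrightarrow>
    \<bar>ball_mean f y \<rho> - ball_mean f y (d y / 20)\<bar> \<le>
      A * (d y powr (- (b / p)) * M powr (1 / p) * \<rho> powr (s - real DIM('a) / p))"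
proof -
  define \<alpha> where "\<alpha> = s - real DIM('a) / p"
  have \<alpha>: "\<alpha> < 0" using sp by (simp add: \<alpha>_def)
  have a2: "2 powr \<alpha> < 1" using \<alpha> powr_less_mono[of \<alpha> 0 2] by simp
  define c where "c = 1 / (1 - 2 powr \<alpha>)"
  have c: "c = 1 + c * 2 powr \<alpha>" "c \<ge> 1" using a2 by (auto simp: c_def divide_simps)
  obtain C where C: "C > 0" "\<And>f x x' r r'. \<lbrakk>f \<in> borel_measurable borel; continuous_on \<Omega> f;
    x \<in> \<Omega>; 0 < r; r \<le> d x / 20; r / 2 \<le> r'; r' \<le> 2 * r; dist x x' \<le> r\<rbrakk> \<Longrightarrow>
    ennreal (\<bar>ball_mean f x r - ball_mean f x' r'\<bar> powr p) \<le>
    ennreal (C * r powr (s * p - real DIM('a))) * (\<integral>\<^sup>+u\<in>ball x r. fractional_energy \<Omega> s p f u \<partial>lborel)"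
    using adjacent_means_oscillation[OF p s] by blast
  define A where "A = (C * 2 powr \<bar>b\<bar>) powr (1 / p)"
  show ?thesis
  proof (intro exI[of _ "A * c"] conjI allI impI)
    show "A * c > 0" using C c by (simp add: A_def)
    fix f :: "'a \<Rightarrow> real" and y \<rho> M
    assume f: "f \<in> borel_measurable borel" "continuous_on \<Omega> f" and y: "y \<in> \<Omega>"
      and \<rho>: "0 < \<rho>" "\<rho> \<le> d y / 20" and M0: "0 \<le> M"
      and M: "(\<integral>\<^sup>+x\<in>\<Omega>. fractional_energy \<Omega> s p f x * ennreal (d x powr b) \<partial>lborel) \<le> ennreal M"
    define B where "B = A * (d y powr (- (b / p)) * M powr (1 / p))"
    have B: "B \<ge> 0" by (simp add: B_def A_def)
    have step: "\<bar>ball_mean f y r - ball_mean f y r'\<bar> \<le> B * r powr \<alpha>"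
      if r: "0 < r" "r \<le> d y / 20" "r / 2 \<le> r'" "r' \<le> 2 * r" for r r'
    proof -
      have "ennreal (\<bar>ball_mean f y r - ball_mean f y r'\<bar> powr p) \<le>
        ennreal (C * r powr (s * p - real DIM('a))) * (\<integral>\<^sup>+u\<in>ball y r. fractional_energy \<Omega> s p f u \<partial>lborel)"
        by (rule C) (use f y r in auto)
      also have "\<dots> \<le> ennreal (C * r powr (s * p - real DIM('a))) * ennreal (2 powr \<bar>b\<bar> * d y powr (- b) * M)"
        by (intro mult_left_mono energy_on_ball f M y r) simp
      finally have "\<bar>ball_mean f y r - ball_mean f y r'\<bar> powr p \<le>
          C * r powr (s * p - real DIM('a)) * (2 powr \<bar>b\<bar> * d y powr (- b) * M)"
        using C M0 by (simp add: ennreal_mult[symmetric])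
      then have "(\<bar>ball_mean f y r - ball_mean f y r'\<bar> powr p) powr (1 / p) \<le>
          (C * r powr (s * p - real DIM('a)) * (2 powr \<bar>b\<bar> * d y powr (- b) * M)) powr (1 / p)"
        using p by (intro powr_mono2) auto
      also have "\<dots> = B * r powr \<alpha>"
        using C M0 p by (simp add: powr_mult powr_powr B_def A_def \<alpha>_def diff_divide_distrib mult_ac)
      finally show ?thesis using p by (simp add: powr_powr)
    qed
    have "\<bar>ball_mean f y \<rho> - ball_mean f y (d y / 20)\<bar> \<le> B * c * \<rho> powr \<alpha>"
      if "0 < \<rho>" "\<rho> \<le> d y / 20" "d y / 20 \<le> 2 ^ J * \<rho>" for J \<rho>
      using that
    proof (induction J arbitrary: \<rho>)
      case 0
      then have eq: "\<rho> = d y / 20" by simp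
      have "\<bar>ball_mean f y \<rho> - ball_mean f y (d y / 20)\<bar> = 0" unfolding eq by simp
      then show ?case using B c by simp
    next
      case (Suc J)
      show ?case
      proof (cases "2 * \<rho> \<le> d y / 20")
        case True
        have "\<bar>ball_mean f y (2 * \<rho>) - ball_mean f y (d y / 20)\<bar> \<le> B * c * (2 * \<rho>) powr \<alpha>"
          using Suc.prems True by (intro Suc.IH) (auto simp: mult_ac)
        moreover have "\<bar>ball_mean f y \<rho> - ball_mean f y (2 * \<rho>)\<bar> \<le> B * \<rho> powr \<alpha>"
          using Suc.prems by (intro step) auto
        moreover have "B * \<rho> powr \<alpha> + B * c * (2 * \<rho>) powr \<alpha> = B * c * \<rho> powr \<alpha>"
        proof -
          have "B * c * \<rho> powr \<alpha> = B * (1 + c * 2 powr \<alpha>) * \<rho> powr \<alpha>" using c(1) by simp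
          then show ?thesis using Suc.prems by (simp add: powr_mult algebra_simps)
        qed
        ultimately show ?thesis by linarith
      next
        case False
        have "\<bar>ball_mean f y \<rho> - ball_mean f y (d y / 20)\<bar> \<le> B * \<rho> powr \<alpha>"
          using Suc.prems False by (intro step) auto
        also have "\<dots> \<le> B * c * \<rho> powr \<alpha>" using B c by (intro mult_right_mono) (auto simp: mult_le_cancel_left1)
        finally show ?thesis .
      qed
    qed
    moreover obtain J where "d y / 20 / \<rho> < 2 ^ J" using real_arch_pow[of 2 "d y / 20 / \<rho>"] by auto
    then have "d y / 20 \<le> 2 ^ J * \<rho>" using \<rho> by (simp add: field_simps)
    ultimately have "\<bar>ball_mean f y \<rho> - ball_mean f y (d y / 20)\<bar> \<le> B * c * \<rho> powr \<alpha>" using \<rho> by blast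
    then show "\<bar>ball_mean f y \<rho> - ball_mean f y (d y / 20)\<bar> \<le>
      A * c * (d y powr (- (b / p)) * M powr (1 / p) * \<rho> powr (s - real DIM('a) / p))"
      by (simp add: B_def \<alpha>_def mult_ac)
  qed
qed

text \<open>Hedberg's optimisation applied to the two preceding estimates. Where the energy at \<open>y\<close> is infinite the
right-hand side is infinite, since \<open>M\<close> is strictly positive.\<close>

lemma local_oscillation:
  assumes p: "p \<ge> 1" "p \<le> q" and s: "s > 0" and sp: "s * p < real DIM('a)"
    and q: "q * (real DIM('a) - s * p) \<le> real DIM('a) * p"
    and e: "b \<le> (a + real DIM('a)) * p / q + s * p - real DIM('a)"
  shows "\<exists>C>0. \<forall>f y M. f \<in> borel_measurable borel \<longrightarrow> continuous_on \<Omega> f \<longrightarrow> y \<in> \<Omega> \<longrightarrow> 0 < M \<longrightarrow>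
    (\<integral>\<^sup>+x\<in>\<Omega>. fractional_energy \<Omega> s p f x * ennreal (d x powr b) \<partial>lborel) \<le> ennreal M \<longrightarrow>
    ennreal (\<bar>f y - ball_mean f y (d y / 20)\<bar> powr q * d y powr a) \<le>
      ennreal (C * M powr (q / p - 1)) * (fractional_energy \<Omega> s p f y * ennreal (d y powr b))"
proof -
  define n where "n = real DIM('a)"
  obtain D where D: "D \<ge> 1" "\<And>x. x \<in> \<Omega> \<Longrightarrow> d x \<le> D" using bdist_bounded by blast
  obtain A1 where A1: "A1 > 0" "\<And>f y \<rho> G. \<lbrakk>f \<in> borel_measurable borel; continuous_on \<Omega> f; y \<in> \<Omega>;
      0 < \<rho>; \<rho> \<le> d y / 20; 0 \<le> G; fractional_energy \<Omega> s p f y = ennreal G\<rbrakk> \<Longrightarrow>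
      \<bar>f y - ball_mean f y \<rho>\<bar> \<le> A1 * (\<rho> powr s * G powr (1 / p))"
    using point_to_mean[OF p(1) s] by blast
  have sp': "s < n / p" using sp p by (simp add: n_def field_simps)
  obtain A2 where A2: "A2 > 0" "\<And>f y \<rho> M. \<lbrakk>f \<in> borel_measurable borel; continuous_on \<Omega> f; y \<in> \<Omega>;
      0 < \<rho>; \<rho> \<le> d y / 20; 0 \<le> M;
      (\<integral>\<^sup>+x\<in>\<Omega>. fractional_energy \<Omega> s p f x * ennreal (d x powr b) \<partial>lborel) \<le> ennreal M\<rbrakk> \<Longrightarrow>
      \<bar>ball_mean f y \<rho> - ball_mean f y (d y / 20)\<bar> \<le>
        A2 * (d y powr (- (b / p)) * M powr (1 / p) * \<rho> powr (s - n / p))"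
    using concentric_means[OF p(1) s, of b] sp' unfolding n_def by blast
  define A where "A = max A1 A2"
  have A: "A > 0" "A1 \<le> A" "A2 \<le> A" using A1 by (auto simp: A_def)
  have q': "q * (n / p - s) \<le> n / p * p" 
  proof -
    have "q * (n / p - s) = q * (n - s * p) / p" using p by (simp add: field_simps)
    also have "\<dots> \<le> n * p / p" using q p by (intro divide_right_mono) (auto simp: n_def)
    finally show ?thesis by simp
  qed
  have e': "0 \<le> a - b / p * q + s * q - n / p * q + n / p * p"
  proof -
    have "b * (q / p) \<le> ((a + n) * p / q + s * p - n) * (q / p)"
      using e p by (intro mult_right_mono) (auto simp: n_def)
    also have "\<dots> = a + n + s * q - n * q / p"
    proof -
      have "(a + n) * p / q * (q / p) = a + n" "s * p * (q / p) = s * q" using p by auto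
      then show ?thesis by (simp add: algebra_simps)
    qed
    finally show ?thesis using p by simp
  qed
  obtain C where C: "C > 0" "\<And>h g E d. \<lbrakk>0 \<le> h; 0 \<le> g; 0 < E; 0 < d; d \<le> D;
    \<And>\<rho>. 0 < \<rho> \<Longrightarrow> \<rho> \<le> d / 20 \<Longrightarrow> h \<le> A * (\<rho> powr s * g + d powr (- (b / p)) * E * \<rho> powr (s - n / p));
    h \<le> A * (d powr s * g)\<rbrakk> \<Longrightarrow> h powr q * d powr a \<le> C * E powr (q - p) * (g powr p * d powr (b / p * p))"
    using Hedberg_interpolation[OF s sp' _ p(2) q' _ A(1) e', of D] p D by auto
  show ?thesis
  proof (intro exI[of _ C] conjI allI impI C(1))
    fix f :: "'a \<Rightarrow> real" and y M
    assume f: "f \<in> borel_measurable borel" "continuous_on \<Omega> f" and y: "y \<in> \<Omega>" and M0: "0 < M"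
      and M: "(\<integral>\<^sup>+x\<in>\<Omega>. fractional_energy \<Omega> s p f x * ennreal (d x powr b) \<partial>lborel) \<le> ennreal M"
    note dy = bdist_pos[OF y]
    show "ennreal (\<bar>f y - ball_mean f y (d y / 20)\<bar> powr q * d y powr a) \<le>
      ennreal (C * M powr (q / p - 1)) * (fractional_energy \<Omega> s p f y * ennreal (d y powr b))"
    proof (cases "fractional_energy \<Omega> s p f y")
      case (real G)
      define h where "h = \<bar>f y - ball_mean f y (d y / 20)\<bar>"
      have "h powr q * d y powr a \<le> C * (M powr (1 / p)) powr (q - p) * ((G powr (1 / p)) powr p * d y powr (b / p * p))"
      proof (rule C)
        fix \<rho> assume \<rho>: "0 < \<rho>" "\<rho> \<le> d y / 20"
        have "h \<le> \<bar>f y - ball_mean f y \<rho>\<bar> + \<bar>ball_mean f y \<rho> - ball_mean f y (d y / 20)\<bar>"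
          by (simp add: h_def)
        also have "\<dots> \<le> A1 * (\<rho> powr s * G powr (1 / p)) +
            A2 * (d y powr (- (b / p)) * M powr (1 / p) * \<rho> powr (s - n / p))"
          using \<rho> f y M0 M real by (intro add_mono A1 A2) auto
        also have "\<dots> \<le> A * (\<rho> powr s * G powr (1 / p)) +
            A * (d y powr (- (b / p)) * M powr (1 / p) * \<rho> powr (s - n / p))"
          using A by (intro add_mono mult_right_mono) auto
        finally show "h \<le> A * (\<rho> powr s * G powr (1 / p) + d y powr (- (b / p)) * M powr (1 / p) * \<rho> powr (s - n / p))"
          by (simp add: distrib_left)
      next
        have "h \<le> A1 * ((d y / 20) powr s * G powr (1 / p))"
          unfolding h_def using dy f y real by (intro A1) auto
        also have "\<dots> \<le> A * (d y powr s * G powr (1 / p))"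
          using A dy A1(1) s p real by (intro mult_mono powr_mono2) auto
        finally show "h \<le> A * (d y powr s * G powr (1 / p))" .
      qed (use M0 dy D y in \<open>auto simp: h_def\<close>)
      also have "\<dots> = C * M powr (q / p - 1) * (G * d y powr b)"
        using p real by (simp add: powr_powr diff_divide_distrib)
      finally have "ennreal (h powr q * d y powr a) \<le> ennreal (C * M powr (q / p - 1) * (G * d y powr b))"
        by (rule ennreal_leI)
      then show ?thesis using real C by (simp add: h_def ennreal_mult)
    next
      case top
      have "C * M powr (q / p - 1) > 0" "d y powr b > 0" using C(1) dy M0 by auto
      then show ?thesis using top C(1) M0 by (simp add: ennreal_top_mult ennreal_mult_top)
    qed
  qed
qed

end

section \<open>Chains along a curve\<close>

text \<open>The next time is the last one at which the curve is in the closed ball of radius \<open>r\<close> around the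
current point. Later points stay outside this ball, which gives the separation; leaving it takes a
minimal time by uniform continuity, so that time 1 is reached after finitely many steps. The final
step may be shorter than \<open>r\<close>, which is why the equality is asserted for \<open>Suc i < m\<close> only.\<close>

lemma last_exit_chain:
  fixes g :: "real \<Rightarrow> 'a::metric_space" and r :: "'a \<Rightarrow> real"
  assumes g: "continuous_on {0..1} g" and r: "continuous_on (g ` {0..1}) r"
    and rpos: "\<And>t. t \<in> {0..1} \<Longrightarrow> r (g t) > 0"
  obtains T :: "nat \<Rightarrow> real" and m where "T 0 = 0" "T m = 1" "\<And>i. 0 \<le> T i \<and> T i \<le> 1" "\<And>i. T i \<le> T (Suc i)"
    "\<And>i. dist (g (T i)) (g (T (Suc i))) \<le> r (g (T i))"
    "\<And>i. Suc i < m \<Longrightarrow> dist (g (T i)) (g (T (Suc i))) = r (g (T i))"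
    "\<And>i j. i < j \<Longrightarrow> j < m \<Longrightarrow> r (g (T i)) \<le> dist (g (T i)) (g (T j))"
proof -
  define S where "S t = {u \<in> {t..1}. dist (g t) (g u) \<le> r (g t)}" for t
  define nxt where "nxt t = Sup (S t)" for t
  have nxt: "nxt t \<in> S t" "\<And>u. u \<in> S t \<Longrightarrow> u \<le> nxt t" if t: "t \<in> {0..1}" for t
  proof -
    have "continuous_on {t..1} (\<lambda>u. dist (g t) (g u))"
      by (intro continuous_intros continuous_on_subset[OF g]) (use t in auto)
    from continuous_closed_preimage[OF this closed_atLeastAtMost, of "{..r (g t)}"]
    have "closed ({t..1} \<inter> (\<lambda>u. dist (g t) (g u)) -` {..r (g t)})" by simp
    moreover have "S t = {t..1} \<inter> (\<lambda>u. dist (g t) (g u)) -` {..r (g t)}" by (auto simp: S_def)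
    ultimately have "closed (S t)" by simp
    moreover have "bdd_above (S t)" by (rule bdd_aboveI[of _ 1]) (auto simp: S_def)
    moreover have "t \<in> S t" using t rpos[OF t] by (simp add: S_def)
    ultimately show "nxt t \<in> S t" "\<And>u. u \<in> S t \<Longrightarrow> u \<le> nxt t"
      unfolding nxt_def using closed_contains_Sup[of "S t"] by (auto intro: cSup_upper)
  qed
  have far: "r (g t) < dist (g t) (g u)" if "t \<in> {0..1}" "nxt t < u" "u \<le> 1" for t u
  proof -
    have "u \<notin> S t" "t \<le> u" using nxt(2)[OF that(1), of u] nxt(1)[OF that(1)] that by (auto simp: S_def)
    then show ?thesis using that(3) by (simp add: S_def)
  qed
  have exact: "dist (g t) (g (nxt t)) = r (g t)" if t: "t \<in> {0..1}" "nxt t < 1" for t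
  proof (rule ccontr)
    assume "dist (g t) (g (nxt t)) \<noteq> r (g t)"
    then have lt: "dist (g t) (g (nxt t)) < r (g t)" using nxt(1)[OF t(1)] by (auto simp: S_def)
    have "continuous_on {nxt t..1} (\<lambda>u. dist (g t) (g u))"
      by (intro continuous_intros continuous_on_subset[OF g]) (use nxt(1)[OF t(1)] t in \<open>auto simp: S_def\<close>)
    then obtain u where u: "nxt t \<le> u" "u \<le> 1" "dist (g t) (g u) = r (g t)"
      using IVT'[of "\<lambda>u. dist (g t) (g u)" "nxt t" "r (g t)" 1] lt far[OF t(1,2)] t by auto
    then show False using far[of t u] t lt by (cases "u = nxt t") auto
  qed
  define T where "T i = (nxt ^^ i) 0" for i
  have T0: "T 0 = 0" and TS: "T (Suc i) = nxt (T i)" for i by (auto simp: T_def)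
  have T01: "T i \<in> {0..1}" for i
  proof (induction i)
    case (Suc i)
    then show ?case using nxt(1)[OF Suc.IH] by (auto simp: TS S_def)
  qed (simp add: T0)
  have Tmono: "T i \<le> T (Suc i)" for i using nxt(1)[OF T01[of i]] by (auto simp: TS S_def)
  have Tle: "T i \<le> T j" if "i \<le> j" for i j using that Tmono by (rule lift_Suc_mono_le[rotated])
  have "\<exists>m. T m = 1"
  proof (rule ccontr)
    assume "\<not> ?thesis"
    then have T1: "T i < 1" for i using T01[of i] by (auto simp: less_le)
    have "compact (g ` {0..1})" using g by (intro compact_continuous_image) auto
    then obtain x where x: "x \<in> g ` {0..1}" "\<And>y. y \<in> g ` {0..1} \<Longrightarrow> r x \<le> r y"
      using continuous_attains_inf[OF _ _ r] by fastforce
    have rx: "r x > 0" using x rpos by auto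
    have "uniformly_continuous_on {0..1} g" using g by (intro compact_uniformly_continuous) auto
    then obtain e where e: "e > 0" "\<And>t u. t \<in> {0..1} \<Longrightarrow> u \<in> {0..1} \<Longrightarrow> dist t u < e \<Longrightarrow> dist (g t) (g u) < r x"
      unfolding uniformly_continuous_on_def using rx by (metis dist_commute)
    have step: "T i + e \<le> T (Suc i)" for i
    proof (rule ccontr)
      assume "\<not> ?thesis"
      then have "dist (T i) (T (Suc i)) < e" using Tmono[of i] by (simp add: dist_real_def)
      then have "dist (g (T i)) (g (T (Suc i))) < r x" using T01 by (intro e)
      moreover have "dist (g (T i)) (g (T (Suc i))) = r (g (T i))"
        using exact[of "T i"] T01[of i] T1[of "Suc i"] by (simp add: TS)
      ultimately show False using x(2)[of "g (T i)"] T01[of i] by auto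
    qed
    have "real i * e \<le> T i" for i
    proof (induction i)
      case (Suc i)
      then show ?case using step[of i] by (simp add: algebra_simps)
    qed (simp add: T0)
    moreover obtain i where "1 / e < real i" using reals_Archimedean2 by blast
    then have "1 < real i * e" using e by (simp add: field_simps)
    ultimately show False using T1[of i] by (smt (verit))
  qed
  define m where "m = (LEAST m. T m = 1)"
  have Tm: "T m = 1" unfolding m_def using \<open>\<exists>m. T m = 1\<close> by (rule LeastI_ex)
  have lessm: "T i < 1" if "i < m" for i
    using not_less_Least[of i "\<lambda>m. T m = 1"] that T01[of i] by (auto simp: m_def less_le)
  show ?thesis
  proof (rule that[of T m])
    show "0 \<le> T i \<and> T i \<le> 1" for i using T01[of i] by simp
    show "dist (g (T i)) (g (T (Suc i))) \<le> r (g (T i))" for i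
      using nxt(1)[OF T01[of i]] by (auto simp: TS S_def)
    show ex: "dist (g (T i)) (g (T (Suc i))) = r (g (T i))" if "Suc i < m" for i
      using exact[of "T i"] T01[of i] lessm[OF that] by (simp add: TS)
    show "r (g (T i)) \<le> dist (g (T i)) (g (T j))" if "i < j" "j < m" for i j
    proof (cases "T j = T (Suc i)")
      case True
      then show ?thesis using ex[of i] that by simp
    next
      case False
      then have "T (Suc i) < T j" using Tle[of "Suc i" j] that by auto
      then show ?thesis using far[of "T i" "T j"] T01[of i] T01[of j] by (simp add: TS)
    qed
  qed (use T0 Tm Tmono in auto)
qed

text \<open>A volume comparison: the balls of radius \<open>e / 2\<close> around the points are disjoint and lie in the ball
of radius \<open>R + e / 2\<close> around \<open>c\<close>.\<close>

lemma card_separated_le: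
  fixes x :: "'i \<Rightarrow> 'a::euclidean_space"
  assumes fin: "finite I" and e: "e > 0" and R: "R \<ge> 0"
    and sep: "\<And>i j. i \<in> I \<Longrightarrow> j \<in> I \<Longrightarrow> i \<noteq> j \<Longrightarrow> e \<le> dist (x i) (x j)"
    and near: "\<And>i. i \<in> I \<Longrightarrow> dist c (x i) \<le> R"
  shows "real (card I) \<le> (1 + 2 * R / e) ^ DIM('a)"
proof -
  define v where "v = unit_vol TYPE('a)"
  have v: "v > 0" by (simp add: v_def)
  have disj: "disjoint_family_on (\<lambda>i. ball (x i) (e / 2)) I"
    unfolding disjoint_family_on_def
  proof (intro ballI impI)
    fix i j assume ij: "i \<in> I" "j \<in> I" "i \<noteq> j"
    have "False" if "z \<in> ball (x i) (e / 2)" "z \<in> ball (x j) (e / 2)" for z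
      using dist_triangle_half_l[of "x i" z e "x j"] that sep[OF ij] by (auto simp: dist_commute)
    then show "ball (x i) (e / 2) \<inter> ball (x j) (e / 2) = {}" by blast
  qed
  have "real (card I) * (v * (e / 2) ^ DIM('a)) = (\<Sum>i\<in>I. measure lborel (ball (x i) (e / 2)))"
    using e by (simp add: content_ball v_def)
  also have "\<dots> = measure lborel (\<Union>i\<in>I. ball (x i) (e / 2))"
    using fin disj by (intro measure_finite_Union[symmetric]) (use e in \<open>auto simp: emeasure_ball\<close>)
  also have "\<dots> \<le> measure lborel (ball c (R + e / 2))"
  proof (rule measure_mono_fmeasurable)
    show "(\<Union>i\<in>I. ball (x i) (e / 2)) \<subseteq> ball c (R + e / 2)"
    proof
      fix z assume "z \<in> (\<Union>i\<in>I. ball (x i) (e / 2))"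
      then obtain i where "i \<in> I" "dist (x i) z < e / 2" by auto
      then show "z \<in> ball c (R + e / 2)" using near[of i] dist_triangle[of c z "x i"] by auto
    qed
    show "(\<Union>i\<in>I. ball (x i) (e / 2)) \<in> sets lborel" by (auto intro!: borel_open open_UN)
    show "ball c (R + e / 2) \<in> fmeasurable lborel" 
      by (rule fmeasurableI) (use e R in \<open>auto simp: emeasure_ball\<close>)
  qed
  also have "\<dots> = v * (R + e / 2) ^ DIM('a)" using e R by (simp add: content_ball v_def)
  finally have "real (card I) * (e / 2) ^ DIM('a) \<le> (R + e / 2) ^ DIM('a)"
    using v by (simp add: mult.left_commute)
  also have "R + e / 2 = (1 + 2 * R / e) * (e / 2)" using e by (simp add: field_simps)
  finally have "real (card I) * (e / 2) ^ DIM('a) \<le> (1 + 2 * R / e) ^ DIM('a) * (e / 2) ^ DIM('a)"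
    by (simp only: power_mult_distrib)
  then show ?thesis using e by (simp only: mult_le_cancel_right_pos zero_less_power half_gt_zero)
qed

context bounded_domain
begin

text \<open>The centres of the balls that contain \<open>u\<close> lie within \<open>d u / 10\<close> of \<open>u\<close> and are separated by
\<open>d u / 40\<close>, because their distances to the boundary are comparable to \<open>d u\<close>. The packing bound for
these two numbers is \<open>9\<^sup>n\<close>.\<close>

lemma chain_overlap:
  fixes x :: "nat \<Rightarrow> 'a"
  assumes x: "\<And>i. i < m \<Longrightarrow> x i \<in> \<Omega>"
    and sep: "\<And>i j. i < j \<Longrightarrow> j < m \<Longrightarrow> d (x i) / 20 \<le> dist (x i) (x j)"
  shows "(\<Sum>i<m. indicator (ball (x i) (d (x i) / 20)) u :: real) \<le> 9 ^ DIM('a)"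
proof -
  define I where "I = {i. i < m \<and> u \<in> ball (x i) (d (x i) / 20)}"
  have fin: "finite I" by (simp add: I_def)
  have "(\<Sum>i<m. indicator (ball (x i) (d (x i) / 20)) u :: real) = real (card I)"
  proof -
    have "(\<Sum>i<m. indicator (ball (x i) (d (x i) / 20)) u :: real) = (\<Sum>i\<in>I. 1)"
      by (rule sum.mono_neutral_cong_right) (auto simp: I_def indicator_def)
    then show ?thesis by simp
  qed
  also have "real (card I) \<le> 9 ^ DIM('a)"
  proof (cases "I = {}")
    case False
    then have u: "d u > 0" using bdist_in_ball(4)[OF x order_refl] by (auto simp: I_def)
    have I: "d (x i) \<ge> d u / 2" "dist u (x i) \<le> d u / 10" if "i \<in> I" for i
      using that bdist_in_ball[OF x order_refl, of i u] by (auto simp: I_def dist_commute)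
    have "real (card I) \<le> (1 + 2 * (d u / 10) / (d u / 40)) ^ DIM('a)"
    proof (rule card_separated_le[OF fin _ _ _ I(2)])
      fix i j assume ij: "i \<in> I" "j \<in> I" "i \<noteq> j"
      then show "d u / 40 \<le> dist (x i) (x j)"
        using sep[of i j] sep[of j i] I(1)[of i] I(1)[of j]
        by (cases "i < j") (auto simp: I_def dist_commute)
    qed (use u in auto)
    then show ?thesis using u by simp
  qed simp
  finally show ?thesis .
qed

text \<open>Write the summand as \<open>d \<cdot> d\<^bsup>e - 1/\<beta>\<^esup>\<close>. The first factor is bounded by the time that the step takes,
and the second by a multiple of \<open>t\<^bsup>\<beta> e - 1\<^esup>\<close> at the end \<open>t\<close> of the step, because \<open>d\<close> is at least a
multiple of \<open>t\<^sup>\<beta>\<close> there. The sum is thus at most a multiple of the integral of \<open>t\<^bsup>\<beta> e - 1\<^esup>\<close> over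
\<open>[0, 1]\<close>. The last step may take arbitrarily little time and is estimated by the bound \<open>D\<close> of \<open>d\<close>.\<close>

lemma chain_sum_bdist:
  fixes x :: "nat \<Rightarrow> 'a" and T :: "nat \<Rightarrow> real"
  assumes T: "T 0 = 0" "\<And>i. 0 \<le> T i \<and> T i \<le> 1" "\<And>i. T i \<le> T (Suc i)"
    and x: "\<And>i. x i \<in> \<Omega>"
    and step: "\<And>i. Suc i < m \<Longrightarrow> d (x i) / 20 \<le> K * (T (Suc i) - T i)"
    and near: "\<And>i. dist (x i) (x (Suc i)) \<le> d (x i) / 20"
    and low: "\<And>i. lam * T i powr \<beta> \<le> d (x i)"
    and par: "lam > 0" "K > 0" "\<beta> \<ge> 1" "0 < e" "e \<le> 1 / \<beta>"
    and D: "D > 0" "\<And>i. d (x i) \<le> D"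
  shows "(\<Sum>i<m. d (x i) powr (1 - 1 / \<beta> + e))
    \<le> 20 * K * (lam / 2) powr (e - 1 / \<beta>) / (\<beta> * e) + D powr (1 - 1 / \<beta> + e)"
proof -
  define \<eta> where "\<eta> = \<beta> * e"
  have \<eta>: "0 < \<eta>" "\<eta> \<le> 1" using par by (auto simp: \<eta>_def field_simps)
  define c where "c = 20 * K * (lam / 2) powr (e - 1 / \<beta>)"
  have c: "c > 0" using par by (simp add: c_def)
  have step_bound: "d (x i) powr (1 - 1 / \<beta> + e) \<le> c / \<eta> * (T (Suc i) powr \<eta> - T i powr \<eta>)" if i: "Suc i < m" for i
  proof -
    have dx: "d (x i) > 0" using x bdist_pos by auto
    have lt: "T i < T (Suc i)" using step[OF i] dx T(3)[of i] par by (cases "T i = T (Suc i)") auto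
    have T0: "0 < T (Suc i)" using lt T(2)[of i] by linarith
    have "lam * T (Suc i) powr \<beta> \<le> d (x (Suc i))" by (rule low)
    also have "\<dots> \<le> d (x i) + dist (x (Suc i)) (x i)" by (rule bdist_triangle)
    also have "\<dots> \<le> 2 * d (x i)" using near[of i] dx by (simp add: dist_commute)
    finally have "lam / 2 * T (Suc i) powr \<beta> \<le> d (x i)" by simp
    then have "d (x i) powr (e - 1 / \<beta>) \<le> (lam / 2 * T (Suc i) powr \<beta>) powr (e - 1 / \<beta>)"
      using par T0 by (intro powr_mono2') auto
    also have "\<dots> = (lam / 2) powr (e - 1 / \<beta>) * T (Suc i) powr (\<eta> - 1)"
      using par by (subst powr_mult) (auto simp: powr_powr \<eta>_def right_diff_distrib)
    finally have 1: "d (x i) powr (e - 1 / \<beta>) \<le> (lam / 2) powr (e - 1 / \<beta>) * T (Suc i) powr (\<eta> - 1)" .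
    have "d (x i) powr (1 - 1 / \<beta> + e) = d (x i) * d (x i) powr (e - 1 / \<beta>)"
      using dx powr_add[of "d (x i)" 1 "e - 1 / \<beta>"] by (simp add: algebra_simps)
    also have "\<dots> \<le> (20 * K * (T (Suc i) - T i)) * ((lam / 2) powr (e - 1 / \<beta>) * T (Suc i) powr (\<eta> - 1))"
      using step[OF i] dx 1 lt par by (intro mult_mono) auto
    also have "\<dots> = c / \<eta> * (\<eta> * (T (Suc i) powr (\<eta> - 1) * (T (Suc i) - T i)))"
      using \<eta> by (simp add: c_def)
    also have "\<dots> \<le> c / \<eta> * (T (Suc i) powr \<eta> - T i powr \<eta>)"
      using c \<eta> T0 T lt by (intro mult_left_mono Bernoulli_powr_step) auto
    finally show ?thesis .
  qed
  have last_bound: "d (x i) powr (1 - 1 / \<beta> + e) \<le> D powr (1 - 1 / \<beta> + e)" for i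
  proof (rule powr_mono2)
    have "1 / \<beta> \<le> 1" using par by (simp add: field_simps)
    then show "0 \<le> 1 - 1 / \<beta> + e" using par by linarith
  qed (use D bdist_nonneg in auto)
  have "(\<Sum>i<m. d (x i) powr (1 - 1 / \<beta> + e)) \<le> c / \<eta> + D powr (1 - 1 / \<beta> + e)"
  proof (cases m)
    case 0
    then show ?thesis using c \<eta> by (simp add: less_imp_le)
  next
    case (Suc k)
    have "(\<Sum>i<k. d (x i) powr (1 - 1 / \<beta> + e)) \<le> (\<Sum>i<k. c / \<eta> * (T (Suc i) powr \<eta> - T i powr \<eta>))"
      using Suc by (intro sum_mono step_bound) auto
    also have "\<dots> = c / \<eta> * (T k powr \<eta> - T 0 powr \<eta>)"
      by (simp only: sum_distrib_left[symmetric] sum_lessThan_telescope[of "\<lambda>i. T i powr \<eta>"])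
    also have "\<dots> \<le> c / \<eta> * 1"
      using c \<eta> T(1,2) powr_le1[of \<eta> "T k"] by (intro mult_left_mono) auto
    finally show ?thesis using Suc last_bound[of k] by simp
  qed
  then show ?thesis by (simp add: c_def \<eta>_def)
qed

text \<open>The difference of the end means telescopes along the last-exit chain. Hoelder's inequality with the
summable weight \<open>d\<^bsup>1 - 1/\<beta> + e\<^esup>\<close> turns the sum of the steps into a sum of energies over the balls of
the chain, at the price of the power \<open>-(1 - 1/\<beta> + e)(p - 1)\<close> of \<open>d\<close>. Bounded overlap replaces this sum
by one integral. A point of a ball reached at time \<open>t\<close> is within a multiple of \<open>d + t\<close> of the starting
point, and \<open>t\<close> is at most a multiple of \<open>d\<^bsup>1/\<beta>\<^esup>\<close>, which gives the region of integration.\<close>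

lemma curve_chain_estimate:
  assumes p: "p \<ge> 1" and s: "s > 0"
    and par: "lam > 0" "K > 0" "\<beta> \<ge> 1" "0 < e" "e \<le> 1 / \<beta>"
    and \<tau>: "\<tau> = s * p - real DIM('a) - (1 - 1 / \<beta> + e) * (p - 1)"
  shows "\<exists>C>0. \<exists>L>0. \<forall>f g. f \<in> borel_measurable borel \<longrightarrow> continuous_on \<Omega> f \<longrightarrow>
    K-lipschitz_on {0..1} g \<longrightarrow> g ` {0..1} \<subseteq> \<Omega> \<longrightarrow> (\<forall>t\<in>{0..1}. lam * t powr \<beta> \<le> d (g t)) \<longrightarrow>
    ennreal (\<bar>ball_mean f (g 0) (d (g 0) / 20) - ball_mean f (g 1) (d (g 1) / 20)\<bar> powr p) \<le>
      ennreal C * (\<integral>\<^sup>+x\<in>{x\<in>\<Omega>. dist x (g 0) \<le> L * d x powr (1 / \<beta>)}.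
        fractional_energy \<Omega> s p f x * ennreal (d x powr \<tau>) \<partial>lborel)"
proof -
  define n where "n = real DIM('a)"
  define \<theta> where "\<theta> = 1 - 1 / \<beta> + e"
  obtain D where D: "D \<ge> 1" "\<And>x. x \<in> \<Omega> \<Longrightarrow> d x \<le> D" using bdist_bounded by blast
  obtain C1 where C1: "C1 > 0" "\<And>f x x' r r'. \<lbrakk>f \<in> borel_measurable borel; continuous_on \<Omega> f;
    x \<in> \<Omega>; 0 < r; r \<le> d x / 20; r / 2 \<le> r'; r' \<le> 2 * r; dist x x' \<le> r\<rbrakk> \<Longrightarrow>
    ennreal (\<bar>ball_mean f x r - ball_mean f x' r'\<bar> powr p) \<le>
    ennreal (C1 * r powr (s * p - n)) * (\<integral>\<^sup>+u\<in>ball x r. fractional_energy \<Omega> s p f u \<partial>lborel)"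
    using adjacent_means_oscillation[OF p s] unfolding n_def by blast
  \<comment> \<open>the bound of \<open>chain_sum_bdist\<close> for the mass of the weight in Hoelder's inequality\<close>
  define W where "W = 20 * K * (lam / 2) powr (e - 1 / \<beta>) / (\<beta> * e) + D powr (1 - 1 / \<beta> + e)"
  have W: "W > 0" unfolding W_def using par D by (intro add_nonneg_pos) auto
  define C2 where "C2 = C1 * (1 / 20) powr (s * p - n) * 2 powr \<bar>\<tau>\<bar>"
  have C2: "C2 > 0" using C1 by (simp add: C2_def)
  define C where "C = W powr (p - 1) * (C2 * 9 ^ DIM('a))"
  \<comment> \<open>the two summands bound the radius of a ball of the chain and the distance travelled to reach it;
    the factor 2 passes from the centre of the ball to its other points\<close>
  define L where "L = 2 * (D powr (1 - 1 / \<beta>) + K * (1 / lam) powr (1 / \<beta>))"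
  have L: "L > 0" unfolding L_def using D par by (intro mult_pos_pos add_pos_nonneg) auto
  show ?thesis
  proof (rule exI[of _ C], intro conjI exI[of _ L] allI impI)
    show "C > 0" using W C2 by (simp add: C_def)
    show "L > 0" by (rule L)
    fix f :: "'a \<Rightarrow> real" and g :: "real \<Rightarrow> 'a"
    assume f [measurable]: "f \<in> borel_measurable borel" and cont: "continuous_on \<Omega> f"
      and lip: "K-lipschitz_on {0..1} g" and sub: "g ` {0..1} \<subseteq> \<Omega>"
      and low: "\<forall>t\<in>{0..1}. lam * t powr \<beta> \<le> d (g t)"
    let ?G = "fractional_energy \<Omega> s p f"
    define Y where "Y = {x\<in>\<Omega>. dist x (g 0) \<le> L * d x powr (1 / \<beta>)}"
    have [measurable]: "Y \<in> sets borel" unfolding Y_def by measurable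
    have g\<Omega>: "g t \<in> \<Omega>" if "t \<in> {0..1}" for t using sub that by blast
    obtain T m where T: "T 0 = 0" "T m = 1" "\<And>i. 0 \<le> T i \<and> T i \<le> 1" "\<And>i. T i \<le> T (Suc i)"
      and near: "\<And>i. dist (g (T i)) (g (T (Suc i))) \<le> d (g (T i)) / 20"
      and exact: "\<And>i. Suc i < m \<Longrightarrow> dist (g (T i)) (g (T (Suc i))) = d (g (T i)) / 20"
      and sep: "\<And>i j. i < j \<Longrightarrow> j < m \<Longrightarrow> d (g (T i)) / 20 \<le> dist (g (T i)) (g (T j))"
    proof (rule last_exit_chain[of g "\<lambda>x. d x / 20"])
      show "continuous_on {0..1} g" using lip by (rule lipschitz_on_continuous_on)
      show "continuous_on (g ` {0..1}) (\<lambda>x. d x / 20)"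
        by (intro continuous_intros continuous_on_subset[OF continuous_bdist]) auto
    qed (use bdist_pos g\<Omega> in auto)
    define x where "x i = g (T i)" for i
    have x: "x i \<in> \<Omega>" for i unfolding x_def using g\<Omega> T(3)[of i] by simp
    have dx: "d (x i) > 0" for i using bdist_pos[OF x] .
    define a where "a i = \<bar>ball_mean f (x i) (d (x i) / 20) - ball_mean f (x (Suc i)) (d (x (Suc i)) / 20)\<bar>" for i
    have a0: "a i \<ge> 0" for i by (simp add: a_def)
    have W_sum: "(\<Sum>i<m. d (x i) powr \<theta>) \<le> W"
      unfolding W_def \<theta>_def
    proof (rule chain_sum_bdist[where T = T])
      show "d (x i) / 20 \<le> K * (T (Suc i) - T i)" if "Suc i < m" for i
        using exact[OF that] lipschitz_onD[OF lip, of "T i" "T (Suc i)"] T(3)[of i] T(3)[of "Suc i"] T(4)[of i]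
        by (simp add: x_def dist_real_def)
      show "lam * T i powr \<beta> \<le> d (x i)" for i using low T(3)[of i] by (simp add: x_def)
    qed (use T x near par D in \<open>auto simp: x_def\<close>)
    have step: "ennreal (a i powr p * d (x i) powr (- \<theta> * (p - 1))) \<le>
        ennreal C2 * (\<integral>\<^sup>+u. ?G u * ennreal (d u powr \<tau>) * indicator (ball (x i) (d (x i) / 20)) u \<partial>lborel)" for i
    proof -
      have dd: "d (x (Suc i)) \<le> d (x i) + d (x i) / 20" "d (x i) \<le> d (x (Suc i)) + d (x i) / 20"
        using bdist_triangle[of "x i" "x (Suc i)"] bdist_triangle[of "x (Suc i)" "x i"] near[of i]
          dist_commute[of "x i" "x (Suc i)"] unfolding x_def by linarith+
      have "ennreal (a i powr p) \<le> ennreal (C1 * (d (x i) / 20) powr (s * p - n)) *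
          (\<integral>\<^sup>+u\<in>ball (x i) (d (x i) / 20). ?G u \<partial>lborel)"
        unfolding a_def by (rule C1) (use f cont x dx[of i] dd near[of i] in \<open>auto simp: x_def\<close>)
      then have "ennreal (d (x i) powr (- \<theta> * (p - 1))) * ennreal (a i powr p) \<le>
          ennreal (d (x i) powr (- \<theta> * (p - 1))) * (ennreal (C1 * (d (x i) / 20) powr (s * p - n)) *
          (\<integral>\<^sup>+u\<in>ball (x i) (d (x i) / 20). ?G u \<partial>lborel))"
        by (rule mult_left_mono) simp
      also have "\<dots> = ennreal (C1 * (1 / 20) powr (s * p - n) * d (x i) powr \<tau>) *
          (\<integral>\<^sup>+u\<in>ball (x i) (d (x i) / 20). ?G u \<partial>lborel)"
      proof -
        have "d (x i) powr (- \<theta> * (p - 1)) * (C1 * (d (x i) / 20) powr (s * p - n)) =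
            C1 * (1 / 20) powr (s * p - n) * (d (x i) powr (- \<theta> * (p - 1)) * d (x i) powr (s * p - n))"
          using dx[of i] by (simp add: powr_divide)
        also have "d (x i) powr (- \<theta> * (p - 1)) * d (x i) powr (s * p - n) = d (x i) powr \<tau>"
          unfolding powr_add[symmetric] by (simp add: \<tau> \<theta>_def n_def algebra_simps)
        finally have eq: "d (x i) powr (- \<theta> * (p - 1)) * (C1 * (d (x i) / 20) powr (s * p - n)) =
            C1 * (1 / 20) powr (s * p - n) * d (x i) powr \<tau>" .
        have "ennreal (d (x i) powr (- \<theta> * (p - 1))) * ennreal (C1 * (d (x i) / 20) powr (s * p - n)) =
            ennreal (C1 * (1 / 20) powr (s * p - n) * d (x i) powr \<tau>)"
          unfolding eq[symmetric] using C1(1) by (intro ennreal_mult[symmetric]) auto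
        then show ?thesis by (simp only: mult.assoc[symmetric])
      qed
      also have "\<dots> = (\<integral>\<^sup>+u. ennreal (C1 * (1 / 20) powr (s * p - n) * d (x i) powr \<tau>) *
          (?G u * indicator (ball (x i) (d (x i) / 20)) u) \<partial>lborel)"
        by (rule nn_integral_cmult[symmetric]) measurable
      also have "\<dots> \<le> (\<integral>\<^sup>+u. ennreal C2 * (?G u * ennreal (d u powr \<tau>) * indicator (ball (x i) (d (x i) / 20)) u) \<partial>lborel)"
      proof (rule nn_integral_mono)
        fix u
        show "ennreal (C1 * (1 / 20) powr (s * p - n) * d (x i) powr \<tau>) * (?G u * indicator (ball (x i) (d (x i) / 20)) u)
          \<le> ennreal C2 * (?G u * ennreal (d u powr \<tau>) * indicator (ball (x i) (d (x i) / 20)) u)"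
        proof (cases "u \<in> ball (x i) (d (x i) / 20)")
          case True
          note u = bdist_in_ball[OF x order_refl True]
          have "d (x i) powr \<tau> \<le> 2 powr \<bar>\<tau>\<bar> * d u powr \<tau>" using u dx[of i] by (intro powr_comparable) auto
          then have "C1 * (1 / 20) powr (s * p - n) * d (x i) powr \<tau> \<le>
              C1 * (1 / 20) powr (s * p - n) * (2 powr \<bar>\<tau>\<bar> * d u powr \<tau>)"
            using C1(1) by (intro mult_left_mono) auto
          also have "\<dots> = C2 * d u powr \<tau>" by (simp add: C2_def)
          finally have "ennreal (C1 * (1 / 20) powr (s * p - n) * d (x i) powr \<tau>) * ?G u \<le> ennreal (C2 * d u powr \<tau>) * ?G u"
            by (intro mult_right_mono ennreal_leI) auto
          then show ?thesis using True C2 by (simp add: ennreal_mult mult_ac)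
        qed simp
      qed
      also have "\<dots> = ennreal C2 * (\<integral>\<^sup>+u. ?G u * ennreal (d u powr \<tau>) * indicator (ball (x i) (d (x i) / 20)) u \<partial>lborel)"
        by (rule nn_integral_cmult) measurable
      finally show ?thesis by (simp add: ennreal_mult mult.commute)
    qed
    have shadow: "u \<in> Y" if u: "u \<in> ball (x i) (d (x i) / 20)" for u i
    proof -
      note u' = bdist_in_ball[OF x order_refl u]
      have "lam * T i powr \<beta> \<le> d (x i)" using low T(3)[of i] by (simp add: x_def)
      then have "(T i powr \<beta>) powr (1 / \<beta>) \<le> (d (x i) * (1 / lam)) powr (1 / \<beta>)"
        using par by (intro powr_mono2) (auto simp: field_simps)
      then have Ti: "T i \<le> d (x i) powr (1 / \<beta>) * (1 / lam) powr (1 / \<beta>)"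
        using par T(3)[of i] dx[of i] by (simp add: powr_powr powr_mult powr_divide)
      have "d (x i) = d (x i) powr (1 - 1 / \<beta>) * d (x i) powr (1 / \<beta>)"
        using dx[of i] by (simp add: powr_add[symmetric])
      also have "\<dots> \<le> D powr (1 - 1 / \<beta>) * d (x i) powr (1 / \<beta>)"
        using dx[of i] D(2)[OF x] par by (intro mult_right_mono powr_mono2) auto
      finally have di: "d (x i) \<le> D powr (1 - 1 / \<beta>) * d (x i) powr (1 / \<beta>)" .
      have "d (x i) powr (1 / \<beta>) \<le> (2 * d u) powr (1 / \<beta>)" using u' dx[of i] par by (intro powr_mono2) auto
      also have "\<dots> = 2 powr (1 / \<beta>) * d u powr (1 / \<beta>)" using u' by (simp add: powr_mult)
      also have "\<dots> \<le> 2 * d u powr (1 / \<beta>)"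
        using powr_mono[of "1 / \<beta>" 1 "2::real"] par by (intro mult_right_mono) auto
      finally have du: "d (x i) powr (1 / \<beta>) \<le> 2 * d u powr (1 / \<beta>)" .
      have "dist u (g 0) \<le> dist u (x i) + dist (x i) (g 0)" by (rule dist_triangle)
      also have "\<dots> \<le> d (x i) + K * T i"
        using u lipschitz_onD[OF lip, of "T i" 0] T(3)[of i] dx[of i] by (auto simp: x_def dist_commute)
      also have "\<dots> \<le> D powr (1 - 1 / \<beta>) * d (x i) powr (1 / \<beta>) + K * (d (x i) powr (1 / \<beta>) * (1 / lam) powr (1 / \<beta>))"
        using di Ti par by (intro add_mono mult_left_mono) auto
      also have "\<dots> = L / 2 * d (x i) powr (1 / \<beta>)" by (simp add: L_def algebra_simps)
      also have "\<dots> \<le> L / 2 * (2 * d u powr (1 / \<beta>))" using du L by (intro mult_left_mono) auto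
      finally show ?thesis using u' by (simp add: Y_def)
    qed
    have overlap: "(\<Sum>i<m. indicator (ball (x i) (d (x i) / 20)) u) \<le> (9 ^ DIM('a) * indicator Y u :: ennreal)" for u
    proof (cases "\<exists>i<m. u \<in> ball (x i) (d (x i) / 20)")
      case True
      then have "u \<in> Y" using shadow by blast
      have "(\<Sum>i<m. indicator (ball (x i) (d (x i) / 20)) u :: real) \<le> 9 ^ DIM('a)"
        using x sep by (intro chain_overlap) (auto simp: x_def)
      then have "ennreal (\<Sum>i<m. indicator (ball (x i) (d (x i) / 20)) u) \<le> ennreal (9 ^ DIM('a))"
        by (rule ennreal_leI)
      then show ?thesis using \<open>u \<in> Y\<close> by (simp add: sum_ennreal[symmetric] ennreal_power[symmetric] ennreal_indicator)
    next
      case False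
      then have "(\<Sum>i<m. indicator (ball (x i) (d (x i) / 20)) u :: ennreal) = 0" by (intro sum.neutral) auto
      then show ?thesis by simp
    qed
    have tel: "\<bar>ball_mean f (g 0) (d (g 0) / 20) - ball_mean f (g 1) (d (g 1) / 20)\<bar> \<le> (\<Sum>i<m. a i)"
    proof -
      have "ball_mean f (x 0) (d (x 0) / 20) - ball_mean f (x m) (d (x m) / 20) =
          (\<Sum>i<m. ball_mean f (x i) (d (x i) / 20) - ball_mean f (x (Suc i)) (d (x (Suc i)) / 20))"
        by (rule sum_lessThan_telescope'[symmetric])
      then show ?thesis unfolding a_def using T by (simp add: x_def sum_abs)
    qed
    \<comment> \<open>weighted Hoelder inequality: \<open>a i\<close> is written as \<open>(a i d\<^bsup>-\<theta>\<^esup>) d\<^sup>\<theta>\<close>\<close>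
    have "ennreal ((\<Sum>i<m. a i) powr p) \<le> ennreal (W powr (p - 1)) *
      (\<integral>\<^sup>+i. ennreal ((a i * d (x i) powr (- \<theta>)) powr p) * ennreal (d (x i) powr \<theta>) \<partial>count_space {..<m})"
    proof (rule nn_integral_jensen_powr[OF _ _ _ p W])
      show "(\<integral>\<^sup>+ i. ennreal (d (x i) powr \<theta>) \<partial>count_space {..<m}) \<le> ennreal W"
        using W_sum by (simp add: nn_integral_count_space_finite sum_ennreal ennreal_leI)
      have "a i * d (x i) powr (- \<theta>) * d (x i) powr \<theta> = a i" for i
        using dx[of i] by (simp add: mult.assoc powr_add[symmetric])
      then have "ennreal (a i * d (x i) powr (- \<theta>)) * ennreal (d (x i) powr \<theta>) = ennreal (a i)" for i
        using a0[of i] by (metis ennreal_mult mult_nonneg_nonneg powr_ge_zero)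
      then show "ennreal (\<Sum>i<m. a i) \<le> (\<integral>\<^sup>+ i. ennreal (a i * d (x i) powr (- \<theta>)) * ennreal (d (x i) powr \<theta>) \<partial>count_space {..<m})"
        using a0 by (simp add: nn_integral_count_space_finite sum_ennreal)
    qed (use a0 in \<open>auto intro: sum_nonneg\<close>)
    also have "(\<integral>\<^sup>+i. ennreal ((a i * d (x i) powr (- \<theta>)) powr p) * ennreal (d (x i) powr \<theta>) \<partial>count_space {..<m})
      = (\<Sum>i<m. ennreal (a i powr p * d (x i) powr (- \<theta> * (p - 1))))"
    proof -
      have "(a i * d (x i) powr (- \<theta>)) powr p * d (x i) powr \<theta> = a i powr p * d (x i) powr (- \<theta> * (p - 1))" for i
        using dx[of i] a0[of i] by (simp add: powr_mult powr_powr powr_add[symmetric] algebra_simps)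
      then show ?thesis by (simp add: nn_integral_count_space_finite ennreal_mult'[symmetric])
    qed
    also have "\<dots> \<le> (\<Sum>i<m. ennreal C2 * (\<integral>\<^sup>+u. ?G u * ennreal (d u powr \<tau>) * indicator (ball (x i) (d (x i) / 20)) u \<partial>lborel))"
      by (intro sum_mono step)
    also have "\<dots> = ennreal C2 * (\<integral>\<^sup>+u. (\<Sum>i<m. ?G u * ennreal (d u powr \<tau>) * indicator (ball (x i) (d (x i) / 20)) u) \<partial>lborel)"
      by (subst nn_integral_sum) (measurable, simp only: sum_distrib_left)
    also have "\<dots> \<le> ennreal C2 * (\<integral>\<^sup>+u. 9 ^ DIM('a) * (?G u * ennreal (d u powr \<tau>) * indicator Y u) \<partial>lborel)"
    proof (intro mult_left_mono nn_integral_mono)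
      fix u
      show "(\<Sum>i<m. ?G u * ennreal (d u powr \<tau>) * indicator (ball (x i) (d (x i) / 20)) u)
          \<le> 9 ^ DIM('a) * (?G u * ennreal (d u powr \<tau>) * indicator Y u)"
        using mult_left_mono[OF overlap[of u] zero_le, of "?G u * ennreal (d u powr \<tau>)"]
        by (simp only: sum_distrib_left mult_ac)
    qed simp
    also have "\<dots> = ennreal C2 * (9 ^ DIM('a) * (\<integral>\<^sup>+u. ?G u * ennreal (d u powr \<tau>) * indicator Y u \<partial>lborel))"
      by (subst nn_integral_cmult) measurable
    also have "ennreal (W powr (p - 1)) * (ennreal C2 * (9 ^ DIM('a) * X)) = ennreal C * X" for X
    proof -
      have "ennreal C = ennreal (W powr (p - 1)) * (ennreal C2 * 9 ^ DIM('a))"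
        using C2 by (simp add: C_def ennreal_mult ennreal_power[symmetric])
      then show ?thesis by (simp add: mult.assoc)
    qed
    finally have "ennreal ((\<Sum>i<m. a i) powr p) \<le> ennreal C * (\<integral>\<^sup>+u\<in>Y. ?G u * ennreal (d u powr \<tau>) \<partial>lborel)"
      by (simp add: mult_left_mono)
    moreover have "\<bar>ball_mean f (g 0) (d (g 0) / 20) - ball_mean f (g 1) (d (g 1) / 20)\<bar> powr p \<le> (\<Sum>i<m. a i) powr p"
      using tel p by (intro powr_mono2) auto
    ultimately show "ennreal (\<bar>ball_mean f (g 0) (d (g 0) / 20) - ball_mean f (g 1) (d (g 1) / 20)\<bar> powr p) \<le>
      ennreal C * (\<integral>\<^sup>+x\<in>{x\<in>\<Omega>. dist x (g 0) \<le> L * d x powr (1 / \<beta>)}. ?G x * ennreal (d x powr \<tau>) \<partial>lborel)"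
      unfolding Y_def[symmetric] using ennreal_leI order_trans by blast
  qed
qed

section \<open>From the chain estimate to the weighted norm\<close>

text \<open>Jensen's inequality for the measure \<open>w\<close> of mass at most \<open>M\<close> moves the power \<open>r\<close> inside the integral,
and Tonelli's theorem leaves the integral of \<open>d\<^sup>a\<close> over \<open>|y - x| \<le> L (d x)\<^bsup>1/\<beta>\<^esup>\<close>, which is at most a
multiple of \<open>(d x)\<^bsup>(n + a)/\<beta>\<^esup>\<close>. The conclusion provides a measurable majorant \<open>\<Phi>\<close>, so that \<open>H\<close> itself may
be any function; the later additivity of the integral is applied to \<open>\<Phi>\<close>.\<close>

lemma shadow_operator_bound:
  assumes r: "r \<ge> 1" and a: "a \<ge> 0" and par: "\<beta> \<ge> 1" "L > 0" "C > 0"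
    and e: "\<sigma> * r + (real DIM('a) + a) / \<beta> \<ge> 0"
  shows "\<exists>C'>0. \<forall>w H M. w \<in> borel_measurable borel \<longrightarrow> 0 < M \<longrightarrow> (\<integral>\<^sup>+x\<in>\<Omega>. w x \<partial>lborel) \<le> ennreal M \<longrightarrow>
    (\<forall>y\<in>\<Omega>. 0 \<le> H y \<and> ennreal (H y) \<le>
      ennreal C * (\<integral>\<^sup>+x\<in>{x\<in>\<Omega>. dist x y \<le> L * d x powr (1 / \<beta>)}. w x * ennreal (d x powr \<sigma>) \<partial>lborel)) \<longrightarrow>
    (\<exists>\<Phi>\<in>borel_measurable borel. (\<forall>y\<in>\<Omega>. ennreal (H y powr r * d y powr a) \<le> \<Phi> y) \<and>
      (\<integral>\<^sup>+y. \<Phi> y \<partial>lborel) \<le> ennreal (C' * M powr r))"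
proof -
  define n where "n = real DIM('a)"
  define v where "v = unit_vol TYPE('a)"
  have v: "v > 0" by (simp add: v_def)
  obtain D where D: "D \<ge> 1" "\<And>x. x \<in> \<Omega> \<Longrightarrow> d x \<le> D" using bdist_bounded by blast
  define B where "B = D powr (1 - 1 / \<beta>) + L"
  have B: "B > 0" using par by (simp add: B_def add_nonneg_pos)
  define c where "c = B powr a * (v * L powr n)"
  have c: "c > 0" using B v par by (simp add: c_def)
  define E where "E = \<sigma> * r + (n + a) / \<beta>"
  have E: "E \<ge> 0" using e by (simp add: E_def n_def)
  define C' where "C' = C powr r * (c * D powr E)"
  show ?thesis
  proof (intro exI[of _ C'] conjI allI impI)
    show "C' > 0" using par c D by (simp add: C'_def)
    fix w :: "'a \<Rightarrow> ennreal" and H :: "'a \<Rightarrow> real" and M :: real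
    assume w [measurable]: "w \<in> borel_measurable borel" and M: "0 < M" "(\<integral>\<^sup>+x\<in>\<Omega>. w x \<partial>lborel) \<le> ennreal M"
      and H: "\<forall>y\<in>\<Omega>. 0 \<le> H y \<and> ennreal (H y) \<le>
      ennreal C * (\<integral>\<^sup>+x\<in>{x\<in>\<Omega>. dist x y \<le> L * d x powr (1 / \<beta>)}. w x * ennreal (d x powr \<sigma>) \<partial>lborel)"
    define k where "k y x = indicator {x\<in>\<Omega>. dist x y \<le> L * d x powr (1 / \<beta>)} x * d x powr \<sigma>" for y x
    define kr where "kr x y = w x * indicator \<Omega> x * ennreal (d x powr (\<sigma> * r)) *
        (ennreal (d y powr a) * indicator {y\<in>\<Omega>. dist x y \<le> L * d x powr (1 / \<beta>)} y)" for x y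
    have kr_meas: "(\<lambda>(x, y). kr x y) \<in> borel_measurable (lborel \<Otimes>\<^sub>M lborel)"
      unfolding kr_def indicator_def mem_Collect_eq by measurable
    have kr_meas' [measurable]: "(\<lambda>(y, x). kr x y) \<in> borel_measurable (borel \<Otimes>\<^sub>M lborel)"
      unfolding kr_def indicator_def mem_Collect_eq by measurable
    define \<Phi> where "\<Phi> y = ennreal (C powr r * M powr (r - 1)) * (\<integral>\<^sup>+x. kr x y \<partial>lborel)" for y
    have inner_meas [measurable]: "(\<lambda>y. \<integral>\<^sup>+x. kr x y \<partial>lborel) \<in> borel_measurable borel"
      by (rule lborel.borel_measurable_nn_integral[OF kr_meas'])
    have \<Phi>_meas: "\<Phi> \<in> borel_measurable borel" unfolding \<Phi>_def by measurable
    have "ennreal (H y powr r * d y powr a) \<le> \<Phi> y" if y: "y \<in> \<Omega>" for y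
    proof -
      have Hy: "0 \<le> H y" using H y by blast
      have [measurable]: "k y \<in> borel_measurable borel" unfolding k_def indicator_def mem_Collect_eq by measurable
      have "ennreal (H y / C) = ennreal (1 / C) * ennreal (H y)" using par Hy by (simp add: ennreal_mult[symmetric])
      also have "\<dots> \<le> ennreal (1 / C) * (ennreal C * (\<integral>\<^sup>+x\<in>{x\<in>\<Omega>. dist x y \<le> L * d x powr (1 / \<beta>)}. w x * ennreal (d x powr \<sigma>) \<partial>lborel))"
        using H y by (intro mult_left_mono) auto
      also have "\<dots> = (\<integral>\<^sup>+x\<in>{x\<in>\<Omega>. dist x y \<le> L * d x powr (1 / \<beta>)}. w x * ennreal (d x powr \<sigma>) \<partial>lborel)"
        using par by (simp add: mult.assoc[symmetric] ennreal_mult[symmetric])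
      also have "\<dots> = (\<integral>\<^sup>+x. ennreal (k y x) * (w x * indicator \<Omega> x) \<partial>lborel)"
        by (intro nn_integral_cong) (auto simp: k_def indicator_def mult_ac)
      finally have "ennreal (H y / C) \<le> (\<integral>\<^sup>+x. ennreal (k y x) * (w x * indicator \<Omega> x) \<partial>lborel)" .
      then have "ennreal ((H y / C) powr r) \<le> ennreal (M powr (r - 1)) *
          (\<integral>\<^sup>+x. ennreal (k y x powr r) * (w x * indicator \<Omega> x) \<partial>lborel)"
        using r M Hy par by (intro nn_integral_jensen_powr) (auto simp: k_def)
      then have "ennreal (C powr r * d y powr a) * ennreal ((H y / C) powr r) \<le> ennreal (C powr r * d y powr a) *
          (ennreal (M powr (r - 1)) * (\<integral>\<^sup>+x. ennreal (k y x powr r) * (w x * indicator \<Omega> x) \<partial>lborel))"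
        by (rule mult_left_mono) simp
      also have "ennreal (C powr r * d y powr a) * ennreal ((H y / C) powr r) = ennreal (H y powr r * d y powr a)"
        using par Hy by (simp add: ennreal_mult[symmetric] powr_divide)
      also have "ennreal (C powr r * d y powr a) *
          (ennreal (M powr (r - 1)) * (\<integral>\<^sup>+x. ennreal (k y x powr r) * (w x * indicator \<Omega> x) \<partial>lborel))
         = ennreal (C powr r * M powr (r - 1)) * (ennreal (d y powr a) * (\<integral>\<^sup>+x. ennreal (k y x powr r) * (w x * indicator \<Omega> x) \<partial>lborel))"
        by (simp add: ennreal_mult mult_ac)
      also have "ennreal (d y powr a) * (\<integral>\<^sup>+x. ennreal (k y x powr r) * (w x * indicator \<Omega> x) \<partial>lborel)
         = (\<integral>\<^sup>+x. ennreal (d y powr a) * (ennreal (k y x powr r) * (w x * indicator \<Omega> x)) \<partial>lborel)"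
        by (rule nn_integral_cmult[symmetric]) measurable
      also have "\<dots> = (\<integral>\<^sup>+x. kr x y \<partial>lborel)"
        using y r by (intro nn_integral_cong) (auto simp: k_def kr_def indicator_def powr_powr mult_ac)
      finally show ?thesis by (simp add: \<Phi>_def)
    qed
    moreover have "(\<integral>\<^sup>+y. \<Phi> y \<partial>lborel) \<le> ennreal (C' * M powr r)"
    proof -
      have "(\<integral>\<^sup>+y. \<Phi> y \<partial>lborel) = ennreal (C powr r * M powr (r - 1)) * (\<integral>\<^sup>+y. (\<integral>\<^sup>+x. kr x y \<partial>lborel) \<partial>lborel)"
        unfolding \<Phi>_def by (rule nn_integral_cmult) measurable
      also have "(\<integral>\<^sup>+y. (\<integral>\<^sup>+x. kr x y \<partial>lborel) \<partial>lborel) = (\<integral>\<^sup>+x. (\<integral>\<^sup>+y. kr x y \<partial>lborel) \<partial>lborel)"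
        by (rule lborel_pair.Fubini'[OF kr_meas])
      also have "\<dots> \<le> (\<integral>\<^sup>+x. ennreal (c * D powr E) * (w x * indicator \<Omega> x) \<partial>lborel)"
      proof (rule nn_integral_mono)
        fix x :: 'a
        show "(\<integral>\<^sup>+y. kr x y \<partial>lborel) \<le> ennreal (c * D powr E) * (w x * indicator \<Omega> x)"
        proof (cases "x \<in> \<Omega>")
          case True
          note dx = bdist_pos[OF True]
          define \<rho> where "\<rho> = d x powr (1 / \<beta>)"
          have \<rho>: "\<rho> > 0" using dx by (simp add: \<rho>_def)
          have "d x = d x powr (1 - 1 / \<beta>) * \<rho>" using dx by (simp add: \<rho>_def powr_add[symmetric])
          also have "\<dots> \<le> D powr (1 - 1 / \<beta>) * \<rho>"
            using dx D(2)[OF True] par \<rho> by (intro mult_right_mono powr_mono2) auto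
          finally have dx\<rho>: "d x \<le> D powr (1 - 1 / \<beta>) * \<rho>" .
          have "(\<integral>\<^sup>+y. kr x y \<partial>lborel) \<le> (\<integral>\<^sup>+y. w x * ennreal (d x powr (\<sigma> * r)) * ennreal ((B * \<rho>) powr a) * indicator (cball x (L * \<rho>)) y \<partial>lborel)"
          proof (rule nn_integral_mono)
            fix y
            show "kr x y \<le> w x * ennreal (d x powr (\<sigma> * r)) * ennreal ((B * \<rho>) powr a) * indicator (cball x (L * \<rho>)) y"
            proof (cases "y \<in> \<Omega> \<and> dist x y \<le> L * \<rho>")
              case y: True
              have "d y \<le> B * \<rho>" using bdist_triangle[of y x] y dx\<rho> by (simp add: B_def dist_commute algebra_simps)
              then have "d y powr a \<le> (B * \<rho>) powr a" using a bdist_nonneg by (intro powr_mono2) auto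
              then have "ennreal (d y powr a) \<le> ennreal ((B * \<rho>) powr a)" by (rule ennreal_leI)
              then show ?thesis using True y by (simp add: kr_def \<rho>_def mult_left_mono)
            qed (auto simp: kr_def \<rho>_def indicator_def)
          qed
          also have "\<dots> = w x * ennreal (d x powr (\<sigma> * r)) * ennreal ((B * \<rho>) powr a) * emeasure lborel (cball x (L * \<rho>))"
            by (rule nn_integral_cmult_indicator) simp
          also have "\<dots> = w x * ennreal (d x powr (\<sigma> * r) * ((B * \<rho>) powr a * (v * (L * \<rho>) powr n)))"
            using \<rho> par v by (simp add: emeasure_cball ennreal_mult mult_ac n_def v_def powr_realpow)
          also have "d x powr (\<sigma> * r) * ((B * \<rho>) powr a * (v * (L * \<rho>) powr n)) = c * d x powr E"
          proof -
            have "\<rho> powr a * \<rho> powr n = d x powr ((n + a) / \<beta>)"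
              by (simp add: \<rho>_def powr_powr powr_add[symmetric] add_divide_distrib add.commute)
            then have "d x powr (\<sigma> * r) * (\<rho> powr a * \<rho> powr n) = d x powr E"
              by (simp add: E_def powr_add[symmetric])
            then show ?thesis using \<rho> B par by (simp add: c_def powr_mult mult_ac)
          qed
          also have "w x * ennreal (c * d x powr E) \<le> w x * ennreal (c * D powr E)"
            using dx D(2)[OF True] E c by (intro mult_left_mono ennreal_leI powr_mono2) auto
          finally show ?thesis using True by (simp add: mult.commute)
        qed (simp add: kr_def)
      qed
      also have "\<dots> = ennreal (c * D powr E) * (\<integral>\<^sup>+x\<in>\<Omega>. w x \<partial>lborel)"
        by (rule nn_integral_cmult) measurable
      also have "\<dots> \<le> ennreal (c * D powr E) * ennreal M" by (intro mult_left_mono M) simp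
      also have "ennreal (C powr r * M powr (r - 1)) * (ennreal (c * D powr E) * ennreal M) = ennreal (C' * M powr r)"
      proof -
        have "M powr r = M powr (r - 1) * M" using M by (simp add: powr_diff)
        then show ?thesis using c M(1) by (simp add: C'_def ennreal_mult[symmetric] mult_ac)
      qed
      finally show ?thesis by (simp add: mult_left_mono)
    qed
    ultimately show "\<exists>\<Phi>\<in>borel_measurable borel. (\<forall>y\<in>\<Omega>. ennreal (H y powr r * d y powr a) \<le> \<Phi> y) \<and>
      (\<integral>\<^sup>+y. \<Phi> y \<partial>lborel) \<le> ennreal (C' * M powr r)"
      using \<Phi>_meas by blast
  qed
qed

end

lemma beta_John_bounded_domain:
  assumes "beta_John_domain \<beta> \<Omega>"
  shows "bounded_domain \<Omega>"
  using assms by unfold_locales (auto simp: beta_John_domain_def)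

text \<open>The two parts are added. The exponent conditions of both parts follow from the hypothesis on \<open>b\<close>:
the local one is its weakening to \<open>\<beta> = 1\<close>, and the global one determines how small \<open>\<epsilon>\<close> has to be.
The bound \<open>M\<close> of the energy is strictly positive because Jensen's inequality divides by it.\<close>

lemma fractional_Poincare_subcritical:
  fixes \<Omega> :: "'a::euclidean_space set"
  assumes \<beta>: "\<beta> \<ge> 1" and John: "beta_John_domain \<beta> \<Omega>"
    and s: "0 < s" and p: "1 < p" "p \<le> q" and a: "a \<ge> 0"
    and b: "b < (real DIM('a) + a) * p / (q * \<beta>) + (p - 1) / \<beta> + s * p - p + 1 - real DIM('a)"
    and sp: "s * p < real DIM('a)" and q: "q * (real DIM('a) - s * p) \<le> real DIM('a) * p"
  shows "\<exists>C>0. \<forall>f M. f \<in> borel_measurable borel \<longrightarrow> continuous_on \<Omega> f \<longrightarrow> 0 < M \<longrightarrow>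
    (\<integral>\<^sup>+x\<in>\<Omega>. fractional_energy \<Omega> s p f x * ennreal (bdist \<Omega> x powr b) \<partial>lborel) \<le> ennreal M \<longrightarrow>
    (\<exists>c. (\<integral>\<^sup>+y\<in>\<Omega>. ennreal (\<bar>f y - c\<bar> powr q * bdist \<Omega> y powr a) \<partial>lborel) \<le> ennreal (C * M powr (q / p)))"
proof -
  interpret bounded_domain \<Omega> using John by (rule beta_John_bounded_domain)
  define n where "n = real DIM('a)"
  have n: "n > 0" by (simp add: n_def)
  obtain \<gamma> lam K C0 where "0 \<in> \<Omega>" and lam: "lam > 0" and K: "K > 0"
    and \<gamma>: "\<And>y. y \<in> \<Omega> \<Longrightarrow> \<gamma> y ` {0..1} \<subseteq> \<Omega> \<and> \<gamma> y 0 = y \<and> \<gamma> y 1 = 0 \<and>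
      (\<forall>t\<in>{0..1}. lam * t powr \<beta> \<le> d (\<gamma> y t)) \<and> speed_bounded (\<gamma> y) K"
    using John unfolding beta_John_domain_def by (metis (no_types, lifting))
  define B where "B = (n + a) * p / (q * \<beta>) + (p - 1) / \<beta> + s * p - p + 1 - n"
  \<comment> \<open>the slack in the strict inequality for b is spent on e\<close>
  define e where "e = min (1 / \<beta>) ((B - b) / (p - 1))"
  have e: "0 < e" "e \<le> 1 / \<beta>" "e * (p - 1) \<le> B - b"
  proof -
    show "0 < e" "e \<le> 1 / \<beta>" using \<beta> b p by (auto simp: e_def B_def n_def)
    have "e \<le> (B - b) / (p - 1)" by (simp add: e_def)
    then show "e * (p - 1) \<le> B - b" using p by (simp add: field_simps)
  qed
  define \<tau> where "\<tau> = s * p - n - (1 - 1 / \<beta> + e) * (p - 1)"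
  have \<tau>: "(\<tau> - b) * (q / p) + (n + a) / \<beta> \<ge> 0"
  proof -
    have "(1 - 1 / \<beta> + e) * (p - 1) = (p - 1) - (p - 1) / \<beta> + e * (p - 1)" by (simp add: algebra_simps diff_divide_distrib)
    then have "\<tau> - b \<ge> - ((n + a) * p / (q * \<beta>))" using e(3) by (simp add: \<tau>_def B_def)
    then have "(\<tau> - b) * (q / p) \<ge> - ((n + a) * p / (q * \<beta>)) * (q / p)" using p by (intro mult_right_mono) auto
    also have "- ((n + a) * p / (q * \<beta>)) * (q / p) = - ((n + a) / \<beta>)" using p \<beta> by (simp add: field_simps)
    finally show ?thesis by simp
  qed
  have loc_exp: "b \<le> (a + n) * p / q + s * p - n"
  proof -
    have "(n + a) * p / (q * \<beta>) \<le> (n + a) * p / q" 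
      using p \<beta> a n by (intro divide_left_mono) (auto simp: mult_le_cancel_left1)
    moreover have "(p - 1) / \<beta> \<le> p - 1" using p \<beta> by (simp add: divide_le_eq mult_le_cancel_left1)
    ultimately show ?thesis using b by (simp add: n_def add.commute)
  qed
  have p1: "p \<ge> 1" using p by simp
  have "\<exists>C>0. \<exists>L>0. \<forall>f g. f \<in> borel_measurable borel \<longrightarrow> continuous_on \<Omega> f \<longrightarrow>
    K-lipschitz_on {0..1} g \<longrightarrow> g ` {0..1} \<subseteq> \<Omega> \<longrightarrow> (\<forall>t\<in>{0..1}. lam * t powr \<beta> \<le> d (g t)) \<longrightarrow>
    ennreal (\<bar>ball_mean f (g 0) (d (g 0) / 20) - ball_mean f (g 1) (d (g 1) / 20)\<bar> powr p) \<le>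
      ennreal C * (\<integral>\<^sup>+x\<in>{x\<in>\<Omega>. dist x (g 0) \<le> L * d x powr (1 / \<beta>)}.
        fractional_energy \<Omega> s p f x * ennreal (d x powr \<tau>) \<partial>lborel)"
    by (rule curve_chain_estimate[OF p1 s lam K \<beta> e(1,2)]) (simp add: \<tau>_def n_def)
  then obtain C1 L where C1: "C1 > 0" and L: "L > 0" and chain: "\<And>f g. \<lbrakk>f \<in> borel_measurable borel; continuous_on \<Omega> f;
    K-lipschitz_on {0..1} g; g ` {0..1} \<subseteq> \<Omega>; \<forall>t\<in>{0..1}. lam * t powr \<beta> \<le> d (g t)\<rbrakk> \<Longrightarrow>
    ennreal (\<bar>ball_mean f (g 0) (d (g 0) / 20) - ball_mean f (g 1) (d (g 1) / 20)\<bar> powr p) \<le>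
      ennreal C1 * (\<integral>\<^sup>+x\<in>{x\<in>\<Omega>. dist x (g 0) \<le> L * d x powr (1 / \<beta>)}.
        fractional_energy \<Omega> s p f x * ennreal (d x powr \<tau>) \<partial>lborel)"
    by blast
  obtain C2 where C2: "C2 > 0" and local_bound: "\<And>f y M. \<lbrakk>f \<in> borel_measurable borel; continuous_on \<Omega> f; y \<in> \<Omega>; 0 < M;
    (\<integral>\<^sup>+x\<in>\<Omega>. fractional_energy \<Omega> s p f x * ennreal (d x powr b) \<partial>lborel) \<le> ennreal M\<rbrakk> \<Longrightarrow>
    ennreal (\<bar>f y - ball_mean f y (d y / 20)\<bar> powr q * d y powr a) \<le>
      ennreal (C2 * M powr (q / p - 1)) * (fractional_energy \<Omega> s p f y * ennreal (d y powr b))"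
    using local_oscillation[OF p1 p(2) s sp q loc_exp[unfolded n_def]] by blast
  have qp: "q / p \<ge> 1" using p by simp
  obtain C3 where C3: "C3 > 0" and shadow: "\<And>w H M. \<lbrakk>w \<in> borel_measurable borel; 0 < M; (\<integral>\<^sup>+x\<in>\<Omega>. w x \<partial>lborel) \<le> ennreal M;
    \<forall>y\<in>\<Omega>. 0 \<le> H y \<and> ennreal (H y) \<le>
      ennreal C1 * (\<integral>\<^sup>+x\<in>{x\<in>\<Omega>. dist x y \<le> L * d x powr (1 / \<beta>)}. w x * ennreal (d x powr (\<tau> - b)) \<partial>lborel)\<rbrakk> \<Longrightarrow>
    \<exists>\<Phi>\<in>borel_measurable borel. (\<forall>y\<in>\<Omega>. ennreal (H y powr (q / p) * d y powr a) \<le> \<Phi> y) \<and>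
      (\<integral>\<^sup>+y. \<Phi> y \<partial>lborel) \<le> ennreal (C3 * M powr (q / p))"
    using shadow_operator_bound[OF qp a \<beta> L C1 \<tau>[unfolded n_def]] by blast
  show ?thesis
  proof (rule exI[of _ "2 powr q * (C2 + C3)"], intro conjI allI impI)
    show "2 powr q * (C2 + C3) > 0" using C2 C3 by simp
    fix f :: "'a \<Rightarrow> real" and M :: real
    assume f [measurable]: "f \<in> borel_measurable borel" and cont: "continuous_on \<Omega> f" and M: "0 < M"
      "(\<integral>\<^sup>+x\<in>\<Omega>. fractional_energy \<Omega> s p f x * ennreal (d x powr b) \<partial>lborel) \<le> ennreal M"
    let ?G = "fractional_energy \<Omega> s p f"
    define m where "m y = ball_mean f y (d y / 20)" for y
    define w where "w x = ?G x * ennreal (d x powr b)" for x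
    have [measurable]: "w \<in> borel_measurable borel" unfolding w_def by measurable
    have "\<exists>\<Phi>\<in>borel_measurable borel. (\<forall>y\<in>\<Omega>. ennreal ((\<bar>m y - m 0\<bar> powr p) powr (q / p) * d y powr a) \<le> \<Phi> y) \<and>
      (\<integral>\<^sup>+y. \<Phi> y \<partial>lborel) \<le> ennreal (C3 * M powr (q / p))"
    proof (rule shadow[of w])
      show "\<forall>y\<in>\<Omega>. 0 \<le> \<bar>m y - m 0\<bar> powr p \<and> ennreal (\<bar>m y - m 0\<bar> powr p) \<le>
        ennreal C1 * (\<integral>\<^sup>+x\<in>{x\<in>\<Omega>. dist x y \<le> L * d x powr (1 / \<beta>)}. w x * ennreal (d x powr (\<tau> - b)) \<partial>lborel)"
      proof (intro ballI conjI)
        fix y assume y: "y \<in> \<Omega>"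
        have ends: "\<gamma> y 0 = y" "\<gamma> y 1 = 0" using \<gamma>[OF y] by auto
        have "ennreal (\<bar>m (\<gamma> y 0) - m (\<gamma> y 1)\<bar> powr p) \<le>
          ennreal C1 * (\<integral>\<^sup>+x\<in>{x\<in>\<Omega>. dist x (\<gamma> y 0) \<le> L * d x powr (1 / \<beta>)}. ?G x * ennreal (d x powr \<tau>) \<partial>lborel)"
          unfolding m_def using \<gamma>[OF y] K by (intro chain f cont speed_bounded_lipschitz) auto
        also have "(\<integral>\<^sup>+x\<in>{x\<in>\<Omega>. dist x (\<gamma> y 0) \<le> L * d x powr (1 / \<beta>)}. ?G x * ennreal (d x powr \<tau>) \<partial>lborel)
           = (\<integral>\<^sup>+x\<in>{x\<in>\<Omega>. dist x y \<le> L * d x powr (1 / \<beta>)}. w x * ennreal (d x powr (\<tau> - b)) \<partial>lborel)"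
          unfolding ends
          by (intro nn_integral_cong)
            (auto simp: indicator_def w_def mult.assoc ennreal_mult[symmetric] powr_add[symmetric] bdist_pos)
        finally show "ennreal (\<bar>m y - m 0\<bar> powr p) \<le>
          ennreal C1 * (\<integral>\<^sup>+x\<in>{x\<in>\<Omega>. dist x y \<le> L * d x powr (1 / \<beta>)}. w x * ennreal (d x powr (\<tau> - b)) \<partial>lborel)"
          unfolding ends .
      qed simp
    qed (use M in \<open>auto simp: w_def\<close>)
    then obtain \<Phi> where [measurable]: "\<Phi> \<in> borel_measurable borel"
      and \<Phi>: "\<And>y. y \<in> \<Omega> \<Longrightarrow> ennreal ((\<bar>m y - m 0\<bar> powr p) powr (q / p) * d y powr a) \<le> \<Phi> y"
      and \<Phi>_int: "(\<integral>\<^sup>+y. \<Phi> y \<partial>lborel) \<le> ennreal (C3 * M powr (q / p))" by blast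
    have "(\<integral>\<^sup>+y\<in>\<Omega>. ennreal (\<bar>f y - m 0\<bar> powr q * d y powr a) \<partial>lborel) \<le>
      (\<integral>\<^sup>+y. ennreal (2 powr q) * (ennreal (C2 * M powr (q / p - 1)) * (w y * indicator \<Omega> y) + \<Phi> y) \<partial>lborel)"
    proof (rule nn_integral_mono)
      fix y
      show "ennreal (\<bar>f y - m 0\<bar> powr q * d y powr a) * indicator \<Omega> y \<le>
        ennreal (2 powr q) * (ennreal (C2 * M powr (q / p - 1)) * (w y * indicator \<Omega> y) + \<Phi> y)"
      proof (cases "y \<in> \<Omega>")
        case True
        have "\<bar>f y - m 0\<bar> powr q \<le> (\<bar>f y - m y\<bar> + \<bar>m y - m 0\<bar>) powr q" using p by (intro powr_mono2) auto
        also have "\<dots> \<le> 2 powr q * (\<bar>f y - m y\<bar> powr q + \<bar>m y - m 0\<bar> powr q)" using p by (intro powr_sum_le) auto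
        finally have "\<bar>f y - m 0\<bar> powr q * d y powr a \<le>
            2 powr q * (\<bar>f y - m y\<bar> powr q + \<bar>m y - m 0\<bar> powr q) * d y powr a"
          by (rule mult_right_mono) simp
        then have "ennreal (\<bar>f y - m 0\<bar> powr q * d y powr a) \<le>
            ennreal (2 powr q * (\<bar>f y - m y\<bar> powr q * d y powr a + \<bar>m y - m 0\<bar> powr q * d y powr a))"
          by (intro ennreal_leI) (simp add: algebra_simps)
        also have "\<dots> = ennreal (2 powr q) * (ennreal (\<bar>f y - m y\<bar> powr q * d y powr a) + ennreal (\<bar>m y - m 0\<bar> powr q * d y powr a))"
          by (simp add: ennreal_mult ennreal_plus)
        also have "\<dots> \<le> ennreal (2 powr q) * (ennreal (C2 * M powr (q / p - 1)) * w y + \<Phi> y)"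
          using \<Phi>[OF True] local_bound[OF f cont True M] p
          by (intro mult_left_mono add_mono) (auto simp: m_def w_def powr_powr)
        finally show ?thesis using True by simp
      qed simp
    qed
    also have "\<dots> = ennreal (2 powr q) * (ennreal (C2 * M powr (q / p - 1)) * (\<integral>\<^sup>+y\<in>\<Omega>. w y \<partial>lborel) + (\<integral>\<^sup>+y. \<Phi> y \<partial>lborel))"
      by (simp add: nn_integral_cmult nn_integral_add)
    also have "\<dots> \<le> ennreal (2 powr q) * (ennreal (C2 * M powr (q / p - 1)) * ennreal M + ennreal (C3 * M powr (q / p)))"
      using M(2) \<Phi>_int by (intro mult_left_mono add_mono) (auto simp: w_def)
    also have "ennreal (C2 * M powr (q / p - 1)) * ennreal M = ennreal (C2 * M powr (q / p))"
      using M(1) C2 by (simp add: ennreal_mult[symmetric] powr_diff)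
    also have "ennreal (2 powr q) * (ennreal (C2 * M powr (q / p)) + ennreal (C3 * M powr (q / p))) =
        ennreal (2 powr q * (C2 + C3) * M powr (q / p))"
      using C2 C3 by (simp add: ennreal_mult[symmetric] ennreal_plus[symmetric] algebra_simps del: ennreal_plus)
    finally show "\<exists>c. (\<integral>\<^sup>+y\<in>\<Omega>. ennreal (\<bar>f y - c\<bar> powr q * d y powr a) \<partial>lborel) \<le>
      ennreal (2 powr q * (C2 + C3) * M powr (q / p))" by blast
  qed
qed

context bounded_domain
begin

section \<open>Lowering the order of smoothness\<close>

text \<open>For \<open>|z - x| \<le> d x / 2\<close> the kernels of order \<open>s'\<close> and \<open>s\<close> differ by the factor
\<open>|z - x|\<^bsup>(s - s') p\<^esup> \<le> (d x)\<^bsup>(s - s') p\<^esup>\<close>, which is compensated in the weight, and the minimum of \<open>d x\<close>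
and \<open>d z\<close> is at least \<open>d x / 2\<close>.\<close>

lemma energy_le_double_integral:
  assumes s: "s' \<le> s" and p: "p > 0"
  shows "\<exists>C>0. \<forall>f. f \<in> borel_measurable borel \<longrightarrow>
    (\<integral>\<^sup>+x\<in>\<Omega>. fractional_energy \<Omega> s' p f x * ennreal (d x powr (b - (s - s') * p)) \<partial>lborel) \<le>
    ennreal C * (\<integral>\<^sup>+x\<in>\<Omega>. (\<integral>\<^sup>+z\<in>{z. norm (x - z) \<le> d x / 2}.
      ennreal (\<bar>f z - f x\<bar> powr p / norm (z - x) powr (real DIM('a) + s * p) * min (d x) (d z) powr b) \<partial>lborel) \<partial>lborel)"
proof (intro exI[of _ "2 powr \<bar>b\<bar>"] conjI allI impI)
  fix f :: "'a \<Rightarrow> real" assume f [measurable]: "f \<in> borel_measurable borel"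
  define n where "n = real DIM('a)"
  define I where "I x z = ennreal (\<bar>f z - f x\<bar> powr p / norm (z - x) powr (n + s * p) * min (d x) (d z) powr b)
    * indicator (cball x (d x / 2)) z" for x z
  have I_meas: "(\<lambda>(x, z). I x z) \<in> borel_measurable (borel \<Otimes>\<^sub>M lborel)"
    unfolding I_def indicator_def mem_cball by measurable
  have I_meas': "(\<lambda>z. I x z) \<in> borel_measurable lborel" for x
    unfolding I_def by measurable
  have [measurable]: "(\<lambda>x. \<integral>\<^sup>+z. I x z \<partial>lborel) \<in> borel_measurable borel"
    by (rule lborel.borel_measurable_nn_integral[OF I_meas])
  have pt: "fractional_energy \<Omega> s' p f x * ennreal (d x powr (b - (s - s') * p)) \<le> ennreal (2 powr \<bar>b\<bar>) * (\<integral>\<^sup>+z. I x z \<partial>lborel)"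
    if x: "x \<in> \<Omega>" for x
  proof -
    note dx = bdist_pos[OF x]
    have "fractional_energy \<Omega> s' p f x * ennreal (d x powr (b - (s - s') * p)) =
      (\<integral>\<^sup>+z. ennreal (d x powr (b - (s - s') * p)) * (ennreal (\<bar>f z - f x\<bar> powr p / norm (z - x) powr (n + s' * p))
         * indicator (cball x (d x / 2)) z) \<partial>lborel)"
      unfolding fractional_energy_def n_def mult.commute[of _ "ennreal (d x powr (b - (s - s') * p))"]
      by (rule nn_integral_cmult[symmetric]) measurable
    also have "\<dots> \<le> (\<integral>\<^sup>+z. ennreal (2 powr \<bar>b\<bar>) * I x z \<partial>lborel)"
    proof (rule nn_integral_mono)
      fix z
      show "ennreal (d x powr (b - (s - s') * p)) * (ennreal (\<bar>f z - f x\<bar> powr p / norm (z - x) powr (n + s' * p))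
         * indicator (cball x (d x / 2)) z) \<le> ennreal (2 powr \<bar>b\<bar>) * I x z"
      proof (cases "z \<in> cball x (d x / 2) \<and> z \<noteq> x")
        case True
        define \<rho> where "\<rho> = norm (z - x)"
        have \<rho>: "0 < \<rho>" "\<rho> \<le> d x / 2" using True by (auto simp: \<rho>_def dist_norm norm_minus_commute)
        have z: "d x / 2 \<le> d z" using bdist_triangle[of x z] \<rho> by (simp add: \<rho>_def dist_norm norm_minus_commute)
        have mn: "d x powr b \<le> 2 powr \<bar>b\<bar> * min (d x) (d z) powr b"
          using z dx by (intro powr_comparable) (auto simp: min_def)
        have "\<rho> powr ((s - s') * p) \<le> d x powr ((s - s') * p)"
          using \<rho> s p by (intro powr_mono2) auto
        then have "\<rho> powr ((s - s') * p) * d x powr (b - (s - s') * p) \<le> d x powr ((s - s') * p) * d x powr (b - (s - s') * p)"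
          by (rule mult_right_mono) simp
        also have "\<dots> = d x powr b" using dx by (simp add: powr_add[symmetric])
        also note mn
        finally have 1: "\<rho> powr ((s - s') * p) * d x powr (b - (s - s') * p) \<le> 2 powr \<bar>b\<bar> * min (d x) (d z) powr b" .
        have "n + s' * p = (n + s * p) - (s - s') * p" by (simp add: algebra_simps)
        then have inv: "1 / \<rho> powr (n + s' * p) = \<rho> powr ((s - s') * p) / \<rho> powr (n + s * p)"
          using \<rho> by (simp only: powr_diff) simp
        have "d x powr (b - (s - s') * p) * (\<bar>f z - f x\<bar> powr p / \<rho> powr (n + s' * p)) =
          \<bar>f z - f x\<bar> powr p * (1 / \<rho> powr (n + s' * p)) * d x powr (b - (s - s') * p)" by simp
        also have "\<dots> = (\<bar>f z - f x\<bar> powr p / \<rho> powr (n + s * p)) * (\<rho> powr ((s - s') * p) * d x powr (b - (s - s') * p))"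
          unfolding inv by simp
        also have "\<dots> \<le> (\<bar>f z - f x\<bar> powr p / \<rho> powr (n + s * p)) * (2 powr \<bar>b\<bar> * min (d x) (d z) powr b)"
          using 1 by (rule mult_left_mono) simp
        finally have "ennreal (d x powr (b - (s - s') * p) * (\<bar>f z - f x\<bar> powr p / \<rho> powr (n + s' * p))) \<le>
          ennreal (2 powr \<bar>b\<bar> * (\<bar>f z - f x\<bar> powr p / \<rho> powr (n + s * p) * min (d x) (d z) powr b))"
          by (intro ennreal_leI) (simp add: mult_ac)
        then show ?thesis using True by (simp add: I_def \<rho>_def[symmetric] ennreal_mult[symmetric])
      qed (use p in \<open>auto simp: indicator_def\<close>)
    qed
    also have "\<dots> = ennreal (2 powr \<bar>b\<bar>) * (\<integral>\<^sup>+z. I x z \<partial>lborel)"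
      by (rule nn_integral_cmult[OF I_meas'])
    finally show ?thesis .
  qed
  have "(\<integral>\<^sup>+x\<in>\<Omega>. fractional_energy \<Omega> s' p f x * ennreal (d x powr (b - (s - s') * p)) \<partial>lborel) \<le>
    (\<integral>\<^sup>+x. ennreal (2 powr \<bar>b\<bar>) * ((\<integral>\<^sup>+z. I x z \<partial>lborel) * indicator \<Omega> x) \<partial>lborel)"
    using pt by (intro nn_integral_mono) (auto simp: indicator_def)
  also have "\<dots> = ennreal (2 powr \<bar>b\<bar>) * (\<integral>\<^sup>+x. (\<integral>\<^sup>+z. I x z \<partial>lborel) * indicator \<Omega> x \<partial>lborel)"
    by (rule nn_integral_cmult) measurable
  finally show "(\<integral>\<^sup>+x\<in>\<Omega>. fractional_energy \<Omega> s' p f x * ennreal (d x powr (b - (s - s') * p)) \<partial>lborel) \<le>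
    ennreal (2 powr \<bar>b\<bar>) * (\<integral>\<^sup>+x\<in>\<Omega>. (\<integral>\<^sup>+z\<in>{z. norm (x - z) \<le> d x / 2}.
      ennreal (\<bar>f z - f x\<bar> powr p / norm (z - x) powr (real DIM('a) + s * p) * min (d x) (d z) powr b) \<partial>lborel) \<partial>lborel)"
    by (simp add: I_def n_def cball_def dist_norm)
qed simp

end

section \<open>The fractional Poincare inequality\<close>

lemma smooth_on_imp_continuous_on: "smooth_on f S \<Longrightarrow> continuous_on S f"
  unfolding smooth_on_def by (drule spec[of _ 0]) simp

theorem theorem4p1:
  fixes \<Omega> :: "'a::euclidean_space set"
    and \<beta> s p q a b :: real
  assumes "DIM('a) \<ge> 2"
    and "\<beta> \<ge> 1"
    and "beta_John_domain \<beta> \<Omega>"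
    and "0 < s" "s < 1"
    and "1 < p" "p \<le> q"
    and "a \<ge> 0"
    and "b < (real DIM('a) + a) * p / (q * \<beta>) + (p - 1) / \<beta> + s * p - p + 1 - real DIM('a)"
    and "p < real DIM('a) / s \<longrightarrow> q \<le> real DIM('a) * p / (real DIM('a) - s * p)"
  shows "\<exists>C>0. \<forall>f :: 'a \<Rightarrow> real. smooth_on f \<Omega> \<longrightarrow>
           (INF c. weighted_Lq_norm \<Omega> q a (\<lambda>y. f y - c))
             \<le> ennreal C * fractional_seminorm \<Omega> s p b f"
proof -
  interpret bounded_domain \<Omega> using assms(3) by (rule beta_John_bounded_domain)
  define n where "n = real DIM('a)"
  have n: "n > 0" by (simp add: n_def)
  have p: "p > 0" "q > 0" using assms by auto
  obtain s' where s': "0 < s'" "s' \<le> s" "s' * p < n" "q * (n - s' * p) \<le> n * p"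
  proof (cases "s * p < n")
    case True
    then have "q \<le> n * p / (n - s * p)" using assms by (auto simp: n_def field_simps)
    then have "q * (n - s * p) \<le> n * p" using True by (simp add: field_simps)
    then show ?thesis using that[of s] True assms by simp
  next
    case False
    \<comment> \<open>chosen so that q (n - s' p) = n p / 2, half of the largest admissible value\<close>
    define s' where "s' = n / p - n / (2 * q)"
    have 1: "s' * p = n - n * p / (2 * q)" using p by (simp add: s'_def field_simps)
    have "n * p / (2 * q) < n" using n p assms by (simp add: divide_less_eq)
    then have "s' * p > 0" using 1 by simp
    then have "s' > 0" using p by (simp add: zero_less_mult_iff)
    moreover have "s' * p < n" using 1 n p by simp
    moreover from this have "s' \<le> s" using False p by (smt (verit) mult_right_mono)
    moreover have "q * (n - s' * p) = n * p / 2" using 1 p by simp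
    then have "q * (n - s' * p) \<le> n * p" using mult_pos_pos[OF n p(1)] by linarith
    ultimately show ?thesis using that by blast
  qed
  define b' where "b' = b - (s - s') * p"
  have b': "b' < (n + a) * p / (q * \<beta>) + (p - 1) / \<beta> + s' * p - p + 1 - n"
    using assms(9) by (simp add: b'_def n_def algebra_simps)
  obtain C where C: "C > 0" and core: "\<And>f M. \<lbrakk>f \<in> borel_measurable borel; continuous_on \<Omega> f; 0 < M;
    (\<integral>\<^sup>+x\<in>\<Omega>. fractional_energy \<Omega> s' p f x * ennreal (d x powr b') \<partial>lborel) \<le> ennreal M\<rbrakk> \<Longrightarrow>
    \<exists>c. (\<integral>\<^sup>+y\<in>\<Omega>. ennreal (\<bar>f y - c\<bar> powr q * d y powr a) \<partial>lborel) \<le> ennreal (C * M powr (q / p))"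
    using fractional_Poincare_subcritical[OF assms(2,3) s'(1) assms(6,7,8) b'[unfolded n_def] s'(3,4)[unfolded n_def]]
    by blast
  obtain C1 where C1: "C1 > 0" and energy: "\<And>f. f \<in> borel_measurable borel \<Longrightarrow>
    (\<integral>\<^sup>+x\<in>\<Omega>. fractional_energy \<Omega> s' p f x * ennreal (d x powr b') \<partial>lborel) \<le>
    ennreal C1 * (\<integral>\<^sup>+x\<in>\<Omega>. (\<integral>\<^sup>+z\<in>{z. norm (x - z) \<le> d x / 2}.
      ennreal (\<bar>f z - f x\<bar> powr p / norm (z - x) powr (real DIM('a) + s * p) * min (d x) (d z) powr b) \<partial>lborel) \<partial>lborel)"
    using energy_le_double_integral[OF s'(2) p(1), of b] unfolding b'_def by blast
  define C2 where "C2 = C powr (1 / q) * C1 powr (1 / p)"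
  have C2: "C2 > 0" using C C1 by (simp add: C2_def)
  show ?thesis
  proof (intro exI[of _ C2] conjI allI impI C2)
    fix f :: "'a \<Rightarrow> real" assume "smooth_on f \<Omega>"
    then have cont: "continuous_on \<Omega> f" by (rule smooth_on_imp_continuous_on)
    \<comment> \<open>outside the domain f may fail to be measurable\<close>
    define F where "F x = (if x \<in> \<Omega> then f x else 0)" for x
    have F: "F \<in> borel_measurable borel"
      unfolding F_def using cont by (intro borel_measurable_continuous_on_if) auto
    have contF: "continuous_on \<Omega> F" using cont by (simp add: F_def cong: continuous_on_cong)
    define J where "J = (\<integral>\<^sup>+x\<in>\<Omega>. (\<integral>\<^sup>+z\<in>{z. norm (x - z) \<le> d x / 2}.
      ennreal (\<bar>f z - f x\<bar> powr p / norm (z - x) powr (real DIM('a) + s * p) * min (d x) (d z) powr b) \<partial>lborel) \<partial>lborel)"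
    have J: "J = (\<integral>\<^sup>+x\<in>\<Omega>. (\<integral>\<^sup>+z\<in>{z. norm (x - z) \<le> d x / 2}.
      ennreal (\<bar>F z - F x\<bar> powr p / norm (z - x) powr (real DIM('a) + s * p) * min (d x) (d z) powr b) \<partial>lborel) \<partial>lborel)"
      unfolding J_def
    proof (rule nn_integral_cong)
      fix x
      show "(\<integral>\<^sup>+z\<in>{z. norm (x - z) \<le> d x / 2}.
      ennreal (\<bar>f z - f x\<bar> powr p / norm (z - x) powr (real DIM('a) + s * p) * min (d x) (d z) powr b) \<partial>lborel) * indicator \<Omega> x =
       (\<integral>\<^sup>+z\<in>{z. norm (x - z) \<le> d x / 2}.
      ennreal (\<bar>F z - F x\<bar> powr p / norm (z - x) powr (real DIM('a) + s * p) * min (d x) (d z) powr b) \<partial>lborel) * indicator \<Omega> x"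
      proof (cases "x \<in> \<Omega>")
        case True
        have "z \<in> \<Omega>" if "norm (x - z) \<le> d x / 2" for z
          using cball_bdist_subset[OF True, of "d x / 2"] bdist_pos[OF True] that by (auto simp: dist_norm)
        then show ?thesis using True
          by (intro arg_cong[where f = "\<lambda>I. I * indicator \<Omega> x"] nn_integral_cong) (auto simp: F_def indicator_def)
      qed simp
    qed
    have seminorm: "fractional_seminorm \<Omega> s p b f = ennreal_powr J (1 / p)"
      by (simp add: fractional_seminorm_def J_def)
    have bound: "(INF c. weighted_Lq_norm \<Omega> q a (\<lambda>y. f y - c)) \<le> ennreal (C powr (1 / q) * M powr (1 / p))"
      if M: "0 < M" "ennreal C1 * J \<le> ennreal M" for M
    proof -
      obtain c where c: "(\<integral>\<^sup>+y\<in>\<Omega>. ennreal (\<bar>F y - c\<bar> powr q * d y powr a) \<partial>lborel) \<le> ennreal (C * M powr (q / p))"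
        using core[OF F contF M(1)] energy[OF F] M(2) unfolding J by (blast intro: order_trans)
      have "(\<integral>\<^sup>+y\<in>\<Omega>. ennreal (\<bar>F y - c\<bar> powr q * d y powr a) \<partial>lborel) = (\<integral>\<^sup>+y\<in>\<Omega>. ennreal (\<bar>f y - c\<bar> powr q * d y powr a) \<partial>lborel)"
        by (intro nn_integral_cong) (auto simp: F_def indicator_def)
      then obtain X where X: "(\<integral>\<^sup>+y\<in>\<Omega>. ennreal (\<bar>f y - c\<bar> powr q * d y powr a) \<partial>lborel) = ennreal X" "0 \<le> X" "X \<le> C * M powr (q / p)"
        using c C by (cases "(\<integral>\<^sup>+y\<in>\<Omega>. ennreal (\<bar>f y - c\<bar> powr q * d y powr a) \<partial>lborel)") (auto simp: top_unique)
      have "X powr (1 / q) \<le> (C * M powr (q / p)) powr (1 / q)" using X p by (intro powr_mono2) auto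
      also have "\<dots> = C powr (1 / q) * M powr (1 / p)" using C p by (simp add: powr_mult powr_powr)
      finally have "weighted_Lq_norm \<Omega> q a (\<lambda>y. f y - c) \<le> ennreal (C powr (1 / q) * M powr (1 / p))"
        using X by (simp add: weighted_Lq_norm_def ennreal_powr_def ennreal_leI)
      then show ?thesis by (rule INF_lower2[OF UNIV_I])
    qed
    show "(INF c. weighted_Lq_norm \<Omega> q a (\<lambda>y. f y - c)) \<le> ennreal C2 * fractional_seminorm \<Omega> s p b f"
    proof (cases J)
      case top
      then show ?thesis using C2 by (simp add: seminorm ennreal_powr_def ennreal_mult_top)
    next
      case (real j)
      show ?thesis
      proof (cases "j = 0")
        case False
        then have j: "j > 0" using real by simp
        have "(INF c. weighted_Lq_norm \<Omega> q a (\<lambda>y. f y - c)) \<le> ennreal (C powr (1 / q) * (C1 * j) powr (1 / p))"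
          using C1 j real by (intro bound) (auto simp: ennreal_mult)
        also have "C powr (1 / q) * (C1 * j) powr (1 / p) = C2 * j powr (1 / p)"
          using C1 j by (simp add: C2_def powr_mult)
        finally show ?thesis using real C2 by (simp add: seminorm ennreal_powr_def ennreal_mult)
      next
        case True
        have "(INF c. weighted_Lq_norm \<Omega> q a (\<lambda>y. f y - c)) \<le> 0"
        proof (rule ennreal_le_epsilon)
          fix \<epsilon> :: real assume \<epsilon>: "0 < \<epsilon>"
          \<comment> \<open>a vanishing double integral is bounded by every positive M\<close>
          define M where "M = (\<epsilon> / C powr (1 / q)) powr p"
          have "(INF c. weighted_Lq_norm \<Omega> q a (\<lambda>y. f y - c)) \<le> ennreal (C powr (1 / q) * M powr (1 / p))"
            using \<epsilon> C True real by (intro bound) (auto simp: M_def)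
          also have "C powr (1 / q) * M powr (1 / p) = \<epsilon>" using \<epsilon> C p by (simp add: M_def powr_powr)
          finally show "(INF c. weighted_Lq_norm \<Omega> q a (\<lambda>y. f y - c)) \<le> 0 + ennreal \<epsilon>" by simp
        qed
        then show ?thesis by simp
      qed
    qed
  qed
qed

end
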